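(* Let $\mathcal{C}$ be a triangulated category with a Bridgeland stability condition $\tau=(\mathcal{P},Z)$, with associated mass function $m_\tau$. Then the set of thin triangles $$\Delta_\tau=\{A\to B\to C\to A[1]\ \text{exact}\;:\; A,B,C\in\mathcal{C},\ m_\tau(B)=m_\tau(A)+m_\tau(C)\}$$ endows $\mathcal{C}$ with an extriangulated structure.
   Context: **Stability condition.** A stability condition $\tau=(\mathcal{P},Z)$ on a triangulated category $\mathcal{C}$ consists of a slicing $\mathcal{P}$, i.e. a full additive subcategory $\mathcal{P}(\phi)\subset\mathcal{C}$ for each $\phi\in\mathbb{R}$ (its objects are called semi-stable of phase $\phi$), and a group homomorphism $Z:K_0(\mathcal{C})\to\mathbb{C}$ (the central charge), such that: (1) $\mathcal{P}(\phi+1)=\mathcal{P}(\phi)[1]$; (2) if $A\in\mathcal{P}(\phi)$, $B\in\mathcal{P}(\psi)$ and $\phi>\psi$ then $\mathrm{Hom}(A,B)=0$; (3) every non-zero $X\in\mathcal{C}$ has a Harder–Narasimhan (HN) filtration, i.e. a sequence $0=X_0\to X_1\to\cdots\to X_n=X$ with exact triangles $X_{i-1}\to X_i\to Y_i\to X_{i-1}[1]$, where $0\neq Y_i\in\mathcal{P}(\phi_i)$ and $\phi_1>\phi_2>\cdots>\phi_n$; (4) $Z(\mathcal{P}(\phi)\setminus\{0\})\subset\mathbb{R}_{>0}\,e^{i\pi\phi}$. **Mass.** $m_\tau(X)=\sum_i|Z(Y_i)|$, the sum running over the HN factors $Y_i$ of $X$, and $m_\tau(0)=0$. **Extriangulated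 structure on a triangulated category.** It is a set $\Delta$ of exact triangles of $\mathcal{C}$ (called extriangles) satisfying: (ET1) If $X\to Y\to Z\xrightarrow{\delta}X[1]$ is in $\Delta$ and $f\in\mathrm{Hom}(X,X')$, then the exact triangle $X'\to E\to Z\xrightarrow{f[1]\circ\delta}X'[1]$ obtained by completing $f[1]\circ\delta$ is in $\Delta$. Similarly, if $g\in\mathrm{Hom}(Z',Z)$, the exact triangle $X\to E'\to Z'\xrightarrow{\delta\circ g}X[1]$ is in $\Delta$. (ET4) If $X\xrightarrow{f}Y\xrightarrow{f'}Z'$ and $Y\xrightarrow{g}Z\xrightarrow{g'}X'$ are (the first two maps of) triangles in $\Delta$, then there exist an object $Y'$ and triangles $X\xrightarrow{h}Z\xrightarrow{h'}Y'$ and $Z'\xrightarrow{d}Y'\xrightarrow{e}X'$ in $\Delta$ with $h=g f$, $h'g=d f'$ and $e h'=g'$. (ET4$^{\rm op}$) If $X\to Y\to Z'$ and $X'\to Z\to Y$ are triangles in $\Delta$, then there exist an object $Y'$ and triangles $Y'\to Z\to Z'$ and $X'\to Y'\to X$ in $\Delta$ such that the evident diagram commutes: $X'\to Y'\to Z$ equals $X'\to Z$; $Y'\to X\to Y$ equals $Y'\to Z\to Y$; and $Z\to Y\to Z'$ equals $Z\to Z'$. *)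

theory Defs
  imports Complex_Main "HOL-Algebra.Free_Abelian_Groups"
begin

record ('o, 'm) category_data =
  Obj :: "'o set"
  Arr :: "'m set"
  Dom :: "'m \<Rightarrow> 'o"
  Cod :: "'m \<Rightarrow> 'o"
  Id :: "'o \<Rightarrow> 'm"
  Comp :: "'m \<Rightarrow> 'm \<Rightarrow> 'm"  (infixl \<open>\<cdot>\<index>\<close> 70)

text \<open>As usual, \<open>g \<cdot> f\<close> is \<open>g\<close> after \<open>f\<close>. It is a total function, meaningful only on composable
  arrows.\<close>

definition Hom :: "('o, 'm, 'z) category_data_scheme \<Rightarrow> 'o \<Rightarrow> 'o \<Rightarrow> 'm set" where
  "Hom C X Y = {f \<in> Arr C. Dom C f = X \<and> Cod C f = Y}"

locale category =
  fixes C (structure)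
  assumes Dom_Obj: "f \<in> Arr C \<Longrightarrow> Dom C f \<in> Obj C"
    and Cod_Obj: "f \<in> Arr C \<Longrightarrow> Cod C f \<in> Obj C"
    and Id_Hom: "X \<in> Obj C \<Longrightarrow> Id C X \<in> Hom C X X"
    and Comp_Hom: "\<lbrakk>f \<in> Hom C X Y; g \<in> Hom C Y W\<rbrakk> \<Longrightarrow> g \<cdot> f \<in> Hom C X W"
    and Comp_Id: "f \<in> Hom C X Y \<Longrightarrow> f \<cdot> Id C X = f"
    and Id_Comp: "f \<in> Hom C X Y \<Longrightarrow> Id C Y \<cdot> f = f"
    and Comp_assoc: "\<lbrakk>f \<in> Hom C X Y; g \<in> Hom C Y W; h \<in> Hom C W V\<rbrakk> \<Longrightarrow> (h \<cdot> g) \<cdot> f = h \<cdot> (g \<cdot> f)"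

definition is_iso :: "('o, 'm, 'z) category_data_scheme \<Rightarrow> 'o \<Rightarrow> 'o \<Rightarrow> 'm \<Rightarrow> bool" where
  "is_iso C X Y f \<longleftrightarrow> f \<in> Hom C X Y \<and>
     (\<exists>g \<in> Hom C Y X. g \<cdot>\<^bsub>C\<^esub> f = Id C X \<and> f \<cdot>\<^bsub>C\<^esub> g = Id C Y)"

definition is_zero_object :: "('o, 'm, 'z) category_data_scheme \<Rightarrow> 'o \<Rightarrow> bool" where
  "is_zero_object C X \<longleftrightarrow> X \<in> Obj C \<and>
     (\<forall>Y \<in> Obj C. (\<exists>!f. f \<in> Hom C X Y) \<and> (\<exists>!f. f \<in> Hom C Y X))"

record ('o, 'm) preadditive_data = "('o, 'm) category_data" +
  Add :: "'m \<Rightarrow> 'm \<Rightarrow> 'm"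
  Zero :: "'o \<Rightarrow> 'o \<Rightarrow> 'm"

definition Hom_group :: "('o, 'm, 'z) preadditive_data_scheme \<Rightarrow> 'o \<Rightarrow> 'o \<Rightarrow> 'm monoid" where
  "Hom_group C X Y = \<lparr>carrier = Hom C X Y, mult = Add C, one = Zero C X Y\<rparr>"

locale preadditive_category = category C for C (structure) +
  assumes Hom_comm_group: "\<lbrakk>X \<in> Obj C; Y \<in> Obj C\<rbrakk> \<Longrightarrow> comm_group (Hom_group C X Y)"
    and Comp_Add_left: "\<lbrakk>f \<in> Hom C X Y; g \<in> Hom C Y W; g' \<in> Hom C Y W\<rbrakk>
      \<Longrightarrow> Add C g g' \<cdot> f = Add C (g \<cdot> f) (g' \<cdot> f)"
    and Comp_Add_right: "\<lbrakk>f \<in> Hom C X Y; f' \<in> Hom C X Y; g \<in> Hom C Y W\<rbrakk>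
      \<Longrightarrow> g \<cdot> Add C f f' = Add C (g \<cdot> f) (g \<cdot> f')"

definition is_biproduct :: "('o, 'm, 'z) preadditive_data_scheme \<Rightarrow> 'o \<Rightarrow> 'o \<Rightarrow> 'o \<Rightarrow> bool" where
  "is_biproduct C A B S \<longleftrightarrow>
     (\<exists>i \<in> Hom C A S. \<exists>j \<in> Hom C B S. \<exists>p \<in> Hom C S A. \<exists>q \<in> Hom C S B.
        p \<cdot>\<^bsub>C\<^esub> i = Id C A \<and> q \<cdot>\<^bsub>C\<^esub> j = Id C B \<and>
        q \<cdot>\<^bsub>C\<^esub> i = Zero C A B \<and> p \<cdot>\<^bsub>C\<^esub> j = Zero C B A \<and>
        Add C (i \<cdot>\<^bsub>C\<^esub> p) (j \<cdot>\<^bsub>C\<^esub> q) = Id C S)"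

text \<open>The full subcategory on the objects \<open>S\<close> is additive. It need not be closed under
  isomorphism. Zero objects and biproducts of a full subcategory are zero objects and biproducts of
  the ambient preadditive category, so it is enough to ask for the latter.\<close>

definition full_additive_subcategory ::
    "('o, 'm, 'z) preadditive_data_scheme \<Rightarrow> 'o set \<Rightarrow> bool" where
  "full_additive_subcategory C S \<longleftrightarrow> S \<subseteq> Obj C \<and>
     (\<exists>N \<in> S. is_zero_object C N) \<and>
     (\<forall>A \<in> S. \<forall>B \<in> S. \<exists>D \<in> S. is_biproduct C A B D)"

locale additive_category = preadditive_category C for C (structure) +
  assumes Obj_additive: "full_additive_subcategory C (Obj C)"

text \<open>A triangle \<open>X \<rightarrow> Y \<rightarrow> W \<rightarrow> X[1]\<close> is stored as the triple of its arrows, which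
  determine the objects.\<close>

record ('o, 'm) triangulated_data = "('o, 'm) preadditive_data" +
  Shift_obj :: "'o \<Rightarrow> 'o"
  Shift :: "'m \<Rightarrow> 'm"
  Exact :: "('m \<times> 'm \<times> 'm) set"

definition is_triangle ::
    "('o, 'm, 'z) triangulated_data_scheme \<Rightarrow> 'o \<Rightarrow> 'o \<Rightarrow> 'o \<Rightarrow> 'm \<times> 'm \<times> 'm \<Rightarrow> bool" where
  "is_triangle C X Y W = (\<lambda>(f, g, h).
     f \<in> Hom C X Y \<and> g \<in> Hom C Y W \<and> h \<in> Hom C W (Shift_obj C X))"

definition is_exact_triangle ::
    "('o, 'm, 'z) triangulated_data_scheme \<Rightarrow> 'o \<Rightarrow> 'o \<Rightarrow> 'o \<Rightarrow> 'm \<times> 'm \<times> 'm \<Rightarrow> bool" where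
  "is_exact_triangle C X Y W T \<longleftrightarrow> is_triangle C X Y W T \<and> T \<in> Exact C"

text \<open>The shift is an additive automorphism of the category (not just an autoequivalence).\<close>

locale triangulated_category = additive_category C for C (structure) +
  assumes Shift_obj_bij: "bij_betw (Shift_obj C) (Obj C) (Obj C)"
    and Shift_bij: "\<lbrakk>X \<in> Obj C; Y \<in> Obj C\<rbrakk>
      \<Longrightarrow> bij_betw (Shift C) (Hom C X Y) (Hom C (Shift_obj C X) (Shift_obj C Y))"
    and Shift_Id: "X \<in> Obj C \<Longrightarrow> Shift C (Id C X) = Id C (Shift_obj C X)"
    and Shift_Comp: "\<lbrakk>f \<in> Hom C X Y; g \<in> Hom C Y W\<rbrakk> \<Longrightarrow> Shift C (g \<cdot> f) = Shift C g \<cdot> Shift C f"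
    and Shift_Add: "\<lbrakk>f \<in> Hom C X Y; g \<in> Hom C X Y\<rbrakk>
      \<Longrightarrow> Shift C (Add C f g) = Add C (Shift C f) (Shift C g)"
    and Exact_triangle: "T \<in> Exact C \<Longrightarrow> \<exists>X Y W. is_triangle C X Y W T"
    and TR1_iso: "\<lbrakk>is_exact_triangle C X Y W (f, g, h); is_triangle C X' Y' W' (f', g', h');
      is_iso C X X' a; is_iso C Y Y' b; is_iso C W W' c;
      b \<cdot> f = f' \<cdot> a; c \<cdot> g = g' \<cdot> b; Shift C a \<cdot> h = h' \<cdot> c\<rbrakk>
      \<Longrightarrow> (f', g', h') \<in> Exact C"
    and TR1_Id: "\<lbrakk>X \<in> Obj C; is_zero_object C N\<rbrakk>
      \<Longrightarrow> (Id C X, Zero C X N, Zero C N (Shift_obj C X)) \<in> Exact C"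
    and TR1_cone: "f \<in> Hom C X Y \<Longrightarrow> \<exists>W g h. is_exact_triangle C X Y W (f, g, h)"
    and TR2: "is_triangle C X Y W (f, g, h) \<Longrightarrow>
      (f, g, h) \<in> Exact C \<longleftrightarrow>
      (g, h, inv\<^bsub>Hom_group C (Shift_obj C X) (Shift_obj C Y)\<^esub> (Shift C f)) \<in> Exact C"
    and TR3: "\<lbrakk>is_exact_triangle C X Y W (f, g, h); is_exact_triangle C X' Y' W' (f', g', h');
      a \<in> Hom C X X'; b \<in> Hom C Y Y'; b \<cdot> f = f' \<cdot> a\<rbrakk>
      \<Longrightarrow> \<exists>c \<in> Hom C W W'. c \<cdot> g = g' \<cdot> b \<and> Shift C a \<cdot> h = h' \<cdot> c"
    and TR4: "\<lbrakk>is_exact_triangle C X Y Q1 (f, p1, d1);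
      is_exact_triangle C X W Q2 (g \<cdot> f, p2, d2);
      is_exact_triangle C Y W Q3 (g, p3, d3)\<rbrakk>
      \<Longrightarrow> \<exists>a b. is_exact_triangle C Q1 Q2 Q3 (a, b, Shift C p1 \<cdot> d3) \<and>
          a \<cdot> p1 = p2 \<cdot> g \<and> d2 \<cdot> a = d1 \<and> b \<cdot> p2 = p3 \<and> d3 \<cdot> b = Shift C f \<cdot> d2"

definition K0_relations :: "('o, 'm, 'z) triangulated_data_scheme \<Rightarrow> ('o \<Rightarrow>\<^sub>0 int) set" where
  "K0_relations C = generate (free_Abelian_group (Obj C))
     {frag_of Y - frag_of X - frag_of W | X Y W. \<exists>T. is_exact_triangle C X Y W T}"

definition K0 :: "('o, 'm, 'z) triangulated_data_scheme \<Rightarrow> ('o \<Rightarrow>\<^sub>0 int) set monoid" where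
  "K0 C = free_Abelian_group (Obj C) Mod K0_relations C"

definition K0_class :: "('o, 'm, 'z) triangulated_data_scheme \<Rightarrow> 'o \<Rightarrow> ('o \<Rightarrow>\<^sub>0 int) set" where
  "K0_class C X = K0_relations C #>\<^bsub>free_Abelian_group (Obj C)\<^esub> frag_of X"

definition complex_group :: "complex monoid" where
  "complex_group = \<lparr>carrier = UNIV, mult = (+), one = 0\<rparr>"

text \<open>A Harder--Narasimhan filtration \<open>0 = F 0 \<rightarrow> F 1 \<rightarrow> \<dots> \<rightarrow> F n = X\<close> with factors
  \<open>Y 0, \<dots>, Y (n - 1)\<close> of phases \<open>\<phi> 0 > \<dots> > \<phi> (n - 1)\<close>. The indices of the factors start
  at \<open>0\<close>; values of \<open>Y\<close> and \<open>\<phi>\<close> from \<open>n\<close> on are irrelevant.\<close>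

definition HN_filtration ::
    "('o, 'm, 'z) triangulated_data_scheme \<Rightarrow> (real \<Rightarrow> 'o set) \<Rightarrow> 'o \<Rightarrow> nat \<Rightarrow>
     (nat \<Rightarrow> 'o) \<Rightarrow> (nat \<Rightarrow> real) \<Rightarrow> bool" where
  "HN_filtration C P X n Y \<phi> \<longleftrightarrow>
     (\<exists>F. is_zero_object C (F 0) \<and> F n = X \<and>
        (\<forall>i<n. \<exists>T. is_exact_triangle C (F i) (F (Suc i)) (Y i) T)) \<and>
     (\<forall>i<n. Y i \<in> P (\<phi> i) \<and> \<not> is_zero_object C (Y i)) \<and>
     (\<forall>i j. i < j \<and> j < n \<longrightarrow> \<phi> j < \<phi> i)"

locale stability_condition =
  fixes C (structure) and P :: "real \<Rightarrow> 'o set" and Z :: "('o \<Rightarrow>\<^sub>0 int) set \<Rightarrow> complex"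
  assumes P_additive: "full_additive_subcategory C (P \<phi>)"
    and Z_hom: "Z \<in> hom (K0 C) complex_group"
    and P_Shift: "P (\<phi> + 1) = Shift_obj C ` P \<phi>"
    and P_Hom: "\<lbrakk>A \<in> P \<phi>; B \<in> P \<psi>; \<phi> > \<psi>\<rbrakk> \<Longrightarrow> Hom C A B = {Zero C A B}"
    and P_HN: "\<lbrakk>X \<in> Obj C; \<not> is_zero_object C X\<rbrakk> \<Longrightarrow> \<exists>n Y \<phi>. HN_filtration C P X n Y \<phi>"
    and Z_phase: "\<lbrakk>A \<in> P \<phi>; \<not> is_zero_object C A\<rbrakk>
      \<Longrightarrow> \<exists>r>0. Z (K0_class C A) = complex_of_real r * exp (\<i> * complex_of_real (pi * \<phi>))"

text \<open>The definite description relies on the uniqueness of Harder--Narasimhan filtrations up to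
  isomorphism.\<close>

definition mass ::
    "('o, 'm, 'z) triangulated_data_scheme \<Rightarrow> (real \<Rightarrow> 'o set) \<Rightarrow>
     (('o \<Rightarrow>\<^sub>0 int) set \<Rightarrow> complex) \<Rightarrow> 'o \<Rightarrow> real" where
  "mass C P Z X = (if is_zero_object C X then 0
     else THE m. \<exists>n Y \<phi>. HN_filtration C P X n Y \<phi> \<and> m = (\<Sum>i<n. cmod (Z (K0_class C (Y i)))))"

definition thin_triangles ::
    "('o, 'm, 'z) triangulated_data_scheme \<Rightarrow> (real \<Rightarrow> 'o set) \<Rightarrow>
     (('o \<Rightarrow>\<^sub>0 int) set \<Rightarrow> complex) \<Rightarrow> ('m \<times> 'm \<times> 'm) set" where
  "thin_triangles C P Z =
     {T. \<exists>A B D. is_exact_triangle C A B D T \<and> mass C P Z B = mass C P Z A + mass C P Z D}"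

text \<open>\<open>X \<rightarrow> Y \<rightarrow> W\<close> are the first two arrows of a triangle in \<open>\<Delta>\<close>.\<close>

definition is_conflation ::
    "('o, 'm, 'z) triangulated_data_scheme \<Rightarrow> ('m \<times> 'm \<times> 'm) set \<Rightarrow>
     'o \<Rightarrow> 'm \<Rightarrow> 'o \<Rightarrow> 'm \<Rightarrow> 'o \<Rightarrow> bool" where
  "is_conflation C \<Delta> X f Y g W \<longleftrightarrow> (\<exists>h. is_triangle C X Y W (f, g, h) \<and> (f, g, h) \<in> \<Delta>)"

text \<open>Completions of an arrow to an exact triangle are unique only up to isomorphism; \<open>ET1\<close> asks
  for all of them to lie in \<open>\<Delta>\<close>.\<close>

locale extriangulated_structure =
  fixes C (structure) and \<Delta> :: "('m \<times> 'm \<times> 'm) set"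
  assumes subset_Exact: "\<Delta> \<subseteq> Exact C"
    and ET1: "\<lbrakk>is_triangle C X Y W (x, y, \<delta>); (x, y, \<delta>) \<in> \<Delta>; f \<in> Hom C X X';
      is_exact_triangle C X' E W (x', y', Shift C f \<cdot> \<delta>)\<rbrakk>
      \<Longrightarrow> (x', y', Shift C f \<cdot> \<delta>) \<in> \<Delta>"
    and ET1_op: "\<lbrakk>is_triangle C X Y W (x, y, \<delta>); (x, y, \<delta>) \<in> \<Delta>; g \<in> Hom C W' W;
      is_exact_triangle C X E W' (x', y', \<delta> \<cdot> g)\<rbrakk>
      \<Longrightarrow> (x', y', \<delta> \<cdot> g) \<in> \<Delta>"
    and ET4: "\<lbrakk>is_conflation C \<Delta> X f Y f' W'; is_conflation C \<Delta> Y g W g' X'\<rbrakk>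
      \<Longrightarrow> \<exists>Y' h' d e. is_conflation C \<Delta> X (g \<cdot> f) W h' Y' \<and> is_conflation C \<Delta> W' d Y' e X' \<and>
          h' \<cdot> g = d \<cdot> f' \<and> e \<cdot> h' = g'"
    and ET4_op: "\<lbrakk>is_conflation C \<Delta> X f Y f' W'; is_conflation C \<Delta> X' g W g' Y\<rbrakk>
      \<Longrightarrow> \<exists>Y' h d e. is_conflation C \<Delta> Y' h W (f' \<cdot> g') W' \<and> is_conflation C \<Delta> X' d Y' e X \<and>
          h \<cdot> d = g \<and> f \<cdot> e = g' \<cdot> h"

end

theory Submission
  imports Defs "HOL-Analysis.Henstock_Kurzweil_Integration"
begin

text \<open>Cutting an object \<open>X\<close> at phase \<open>\<theta>\<close> gives a triangle \<open>U \<rightarrow> X \<rightarrow> V\<close>, where \<open>U\<close> carries the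
  Harder--Narasimhan factors of phase \<open>> \<theta>\<close>. Put \<open>u\<^sub>\<theta>(X) = Im (Z(U) e\<^sup>-\<^sup>i\<^sup>\<pi>\<^sup>\<theta>)\<close>. A semistable factor of phase
  \<open>\<phi>\<close> contributes \<open>|Z| sin \<pi>(\<phi> - \<theta>)\<close> for \<open>\<theta> < \<phi>\<close> and nothing afterwards, so integrating over
  \<open>\<theta> \<in> [a, b]\<close>, an interval containing all phases, gives
  \<open>m(X) = Re (Z(X) e\<^sup>-\<^sup>i\<^sup>\<pi>\<^sup>a) + \<pi> \<integral> u\<^sub>\<theta>(X) d\<theta>\<close>. As \<open>Z\<close> is additive on triangles, the triangle
  inequality for the mass follows from subadditivity of \<open>u\<^sub>\<theta>\<close>, and additivity of the mass on split
  triangles from additivity of \<open>u\<^sub>\<theta>\<close>. Both come from the octahedral axiom.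

  Given the two facts, thinness in \<open>ET4\<close> and its dual is forced by the triangle inequality in the
  octahedron. For \<open>ET1\<close>, the homotopy pushout \<open>X \<rightarrow> Y \<oplus> X' \<rightarrow> E\<close> yields
  \<open>m(Y) + m(X') \<le> m(X) + m(E)\<close>, which together with \<open>m(Y) = m(X) + m(W)\<close> is the missing inequality
  \<open>m(X') + m(W) \<le> m(E)\<close>; the dual is similar.\<close>

section \<open>Consequences of the axioms of a triangulated category\<close>

context category
begin

lemma Hom_Obj:
  assumes "f \<in> Hom C X Y"
  shows "X \<in> Obj C" "Y \<in> Obj C"
  using assms Dom_Obj Cod_Obj by (auto simp: Hom_def)

end

section \<open>Signs, zero morphisms and zero objects\<close>

context preadditive_category
begin

text \<open>The Hom group is read off from domain and codomain, so the sign in \<open>TR2\<close>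
  can be written without naming objects.\<close>

definition neg :: "'b \<Rightarrow> 'b" where
  "neg f = inv\<^bsub>Hom_group C (Dom C f) (Cod C f)\<^esub> f"

lemma group_Hom: "\<lbrakk>X \<in> Obj C; Y \<in> Obj C\<rbrakk> \<Longrightarrow> group (Hom_group C X Y)"
  by (rule comm_group.axioms(2)[OF Hom_comm_group])

lemma neg_eq: "f \<in> Hom C X Y \<Longrightarrow> neg f = inv\<^bsub>Hom_group C X Y\<^esub> f"
  by (simp add: neg_def Hom_def)

lemma Zero_Hom: "\<lbrakk>X \<in> Obj C; Y \<in> Obj C\<rbrakk> \<Longrightarrow> Zero C X Y \<in> Hom C X Y"
  using group_Hom[THEN group.is_monoid, THEN monoid.one_closed]
  by (simp add: Hom_group_def)

lemma neg_Hom: "f \<in> Hom C X Y \<Longrightarrow> neg f \<in> Hom C X Y"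
  using group.inv_closed[OF group_Hom[OF Hom_Obj[of f X Y]], of f]
  by (simp add: neg_eq Hom_group_def)

lemma neg_neg:
  assumes "f \<in> Hom C X Y"
  shows "neg (neg f) = f"
  using group.inv_inv[OF group_Hom[OF Hom_Obj[OF assms]], of f] assms
  unfolding neg_eq[OF neg_Hom[OF assms]] unfolding neg_eq[OF assms] by (simp add: Hom_group_def)

lemma Add_neg: "f \<in> Hom C X Y \<Longrightarrow> Add C (neg f) f = Zero C X Y"
  using group.l_inv[OF group_Hom[OF Hom_Obj[of f X Y]], of f]
  by (simp add: neg_eq Hom_group_def)

lemma neg_unique: "\<lbrakk>f \<in> Hom C X Y; g \<in> Hom C X Y; Add C g f = Zero C X Y\<rbrakk> \<Longrightarrow> g = neg f"
  using group.inv_equality[OF group_Hom[OF Hom_Obj[of f X Y]], of g f]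
  by (simp add: neg_eq Hom_group_def)

lemma Add_idem: "\<lbrakk>f \<in> Hom C X Y; Add C f f = f\<rbrakk> \<Longrightarrow> f = Zero C X Y"
  using group.l_cancel_one[OF group_Hom[OF Hom_Obj[of f X Y]], of f f]
  by (simp add: Hom_group_def)

lemma Add_Zero: "f \<in> Hom C X Y \<Longrightarrow> Add C f (Zero C X Y) = f"
  using monoid.r_one[OF group.is_monoid[OF group_Hom[OF Hom_Obj[of f X Y]]], of f]
  by (simp add: Hom_group_def)

lemma Comp_Zero:
  assumes "g \<in> Hom C Y W" "X \<in> Obj C"
  shows "g \<cdot> Zero C X Y = Zero C X W"
proof -
  have z: "Zero C X Y \<in> Hom C X Y" using assms Zero_Hom Hom_Obj by blast
  have "g \<cdot> Add C (Zero C X Y) (Zero C X Y) = Add C (g \<cdot> Zero C X Y) (g \<cdot> Zero C X Y)"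
    using Comp_Add_right[OF z z assms(1)] .
  thus ?thesis using Add_idem Comp_Hom[OF z assms(1)] Add_Zero[OF z] by auto
qed

lemma Zero_Comp:
  assumes "g \<in> Hom C X Y" "W \<in> Obj C"
  shows "Zero C Y W \<cdot> g = Zero C X W"
proof -
  have z: "Zero C Y W \<in> Hom C Y W" using assms Zero_Hom Hom_Obj by blast
  have "Add C (Zero C Y W) (Zero C Y W) \<cdot> g = Add C (Zero C Y W \<cdot> g) (Zero C Y W \<cdot> g)"
    using Comp_Add_left[OF assms(1) z z] .
  thus ?thesis using Add_idem Comp_Hom[OF assms(1) z] Add_Zero[OF z] by auto
qed

lemma neg_Comp:
  assumes "f \<in> Hom C X Y" "g \<in> Hom C Y W"
  shows "neg g \<cdot> f = neg (g \<cdot> f)"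
proof (rule neg_unique)
  show "Add C (neg g \<cdot> f) (g \<cdot> f) = Zero C X W"
    using Comp_Add_left[OF assms(1) neg_Hom[OF assms(2)] assms(2)] Add_neg[OF assms(2)]
      Zero_Comp[OF assms(1)] Hom_Obj[OF assms(2)] by simp
qed (use assms Comp_Hom neg_Hom in blast)+

lemma Comp_neg:
  assumes "f \<in> Hom C X Y" "g \<in> Hom C Y W"
  shows "g \<cdot> neg f = neg (g \<cdot> f)"
proof (rule neg_unique)
  show "Add C (g \<cdot> neg f) (g \<cdot> f) = Zero C X W"
    using Comp_Add_right[OF neg_Hom[OF assms(1)] assms(1) assms(2)] Add_neg[OF assms(1)]
      Comp_Zero[OF assms(2)] Hom_Obj[OF assms(1)] by simp
qed (use assms Comp_Hom neg_Hom in blast)+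

lemma neg_inject: "\<lbrakk>f \<in> Hom C X Y; g \<in> Hom C X Y; neg f = neg g\<rbrakk> \<Longrightarrow> f = g"
  using neg_neg by metis

lemma neg_Zero: "\<lbrakk>X \<in> Obj C; Y \<in> Obj C\<rbrakk> \<Longrightarrow> neg (Zero C X Y) = Zero C X Y"
  using neg_unique[OF Zero_Hom Zero_Hom] Add_Zero[OF Zero_Hom] by metis

lemma zero_object_iff: "is_zero_object C X \<longleftrightarrow> X \<in> Obj C \<and> Id C X = Zero C X X"
proof
  assume "is_zero_object C X"
  thus "X \<in> Obj C \<and> Id C X = Zero C X X"
    unfolding is_zero_object_def using Id_Hom Zero_Hom by blast
next
  assume X: "X \<in> Obj C \<and> Id C X = Zero C X X"
  have "f = Zero C X Y" if "f \<in> Hom C X Y" for f Y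
    using Comp_Id[OF that] Comp_Zero[OF that] X by simp
  moreover have "f = Zero C Y X" if "f \<in> Hom C Y X" for f Y
    using Id_Comp[OF that] Zero_Comp[OF that] X by simp
  ultimately show "is_zero_object C X"
    unfolding is_zero_object_def using X Zero_Hom by blast
qed

lemma zero_object_Obj: "is_zero_object C X \<Longrightarrow> X \<in> Obj C"
  by (simp add: zero_object_iff)

lemma Hom_from_zero: "\<lbrakk>is_zero_object C X; f \<in> Hom C X Y\<rbrakk> \<Longrightarrow> f = Zero C X Y"
  using Comp_Id Comp_Zero zero_object_iff by metis

lemma Hom_to_zero: "\<lbrakk>is_zero_object C Y; f \<in> Hom C X Y\<rbrakk> \<Longrightarrow> f = Zero C X Y"
  using Id_Comp Zero_Comp zero_object_iff by metis

lemma is_iso_Id: "X \<in> Obj C \<Longrightarrow> is_iso C X X (Id C X)"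
  unfolding is_iso_def using Id_Hom Comp_Id by blast

lemma is_iso_neg_Id:
  assumes "X \<in> Obj C" shows "is_iso C X X (neg (Id C X))"
proof -
  note i = Id_Hom[OF assms]
  have "neg (Id C X) \<cdot> neg (Id C X) = Id C X"
    using neg_Comp[OF neg_Hom[OF i] i] Comp_neg[OF i i] Comp_Id[OF i] neg_neg[OF i] by simp
  thus ?thesis unfolding is_iso_def using neg_Hom[OF i] by blast
qed

end

lemma (in additive_category) obtains_zero_object:
  obtains N where "is_zero_object C N"
  using Obj_additive unfolding full_additive_subcategory_def by blast

section \<open>Rotation, shift and exactness of Hom\<close>

context triangulated_category
begin

abbreviation S :: "'a \<Rightarrow> 'a" where "S \<equiv> Shift_obj C"
abbreviation Sh :: "'b \<Rightarrow> 'b" where "Sh \<equiv> Shift C"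

abbreviation tri :: "'a \<Rightarrow> 'a \<Rightarrow> 'a \<Rightarrow> 'b \<Rightarrow> 'b \<Rightarrow> 'b \<Rightarrow> bool" where
  "tri X Y W f g h \<equiv> is_exact_triangle C X Y W (f, g, h)"

lemma S_Obj: "X \<in> Obj C \<Longrightarrow> S X \<in> Obj C"
  using Shift_obj_bij bij_betwE by blast

lemma Sh_Hom: "f \<in> Hom C X Y \<Longrightarrow> Sh f \<in> Hom C (S X) (S Y)"
  using Shift_bij Hom_Obj bij_betwE by blast

lemma Sh_inject: "\<lbrakk>f \<in> Hom C X Y; g \<in> Hom C X Y; Sh f = Sh g\<rbrakk> \<Longrightarrow> f = g"
  using Shift_bij[of X Y] Hom_Obj[of f X Y] unfolding bij_betw_def inj_on_def by blast

lemma Sh_surj: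
  assumes "f \<in> Hom C (S X) (S Y)" "X \<in> Obj C" "Y \<in> Obj C"
  obtains f' where "f' \<in> Hom C X Y" "f = Sh f'"
  using Shift_bij[OF assms(2,3)] assms(1) unfolding bij_betw_def by blast

lemma S_surj:
  assumes "X \<in> Obj C"
  obtains X' where "X' \<in> Obj C" "X = S X'"
  using Shift_obj_bij assms unfolding bij_betw_def by blast

lemma Sh_Zero:
  assumes "X \<in> Obj C" "Y \<in> Obj C"
  shows "Sh (Zero C X Y) = Zero C (S X) (S Y)"
proof -
  have z: "Zero C X Y \<in> Hom C X Y" using assms Zero_Hom by blast
  show ?thesis
    using Shift_Add[OF z z] Add_Zero[OF z] Sh_Hom[OF z] Add_idem by simp
qed

lemma Sh_neg:
  assumes "f \<in> Hom C X Y"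
  shows "Sh (neg f) = neg (Sh f)"
  using neg_unique[OF Sh_Hom[OF assms] Sh_Hom[OF neg_Hom[OF assms]]]
    Shift_Add[OF neg_Hom[OF assms] assms] Add_neg[OF assms] Sh_Zero[OF Hom_Obj[OF assms]] by simp

lemma S_zero_iff:
  assumes "X \<in> Obj C"
  shows "is_zero_object C (S X) \<longleftrightarrow> is_zero_object C X"
  using assms S_Obj[OF assms] Shift_Id[OF assms] Sh_Zero[OF assms assms]
    Sh_inject[OF Id_Hom[OF assms] Zero_Hom[OF assms assms]] zero_object_iff by metis

lemma tri_Hom:
  assumes "tri X Y W f g h"
  shows "f \<in> Hom C X Y" "g \<in> Hom C Y W" "h \<in> Hom C W (S X)"
  using assms by (auto simp: is_exact_triangle_def is_triangle_def)

lemma tri_Obj: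
  assumes "tri X Y W f g h"
  shows "X \<in> Obj C" "Y \<in> Obj C" "W \<in> Obj C"
  using tri_Hom[OF assms] Hom_Obj by blast+

lemma rotate_iff:
  assumes "f \<in> Hom C X Y"
  shows "tri Y W (S X) g h (neg (Sh f)) \<longleftrightarrow> tri X Y W f g h"
proof -
  have "(f, g, h) \<in> Exact C \<longleftrightarrow> (g, h, neg (Sh f)) \<in> Exact C" if "g \<in> Hom C Y W" "h \<in> Hom C W (S X)"
    using TR2[of X Y W f g h] that assms neg_eq[OF Sh_Hom[OF assms]] by (simp add: is_triangle_def)
  thus ?thesis
    using assms neg_Hom[OF Sh_Hom[OF assms]] by (auto simp: is_exact_triangle_def is_triangle_def)
qed

lemma rotate: "tri X Y W f g h \<Longrightarrow> tri Y W (S X) g h (neg (Sh f))"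
  using rotate_iff tri_Hom by blast

lemma shift_iff:
  assumes "f \<in> Hom C X Y" "g \<in> Hom C Y W" "h \<in> Hom C W (S X)"
  shows "tri (S X) (S Y) (S W) (neg (Sh f)) (neg (Sh g)) (neg (Sh h)) \<longleftrightarrow> tri X Y W f g h"
  using rotate_iff assms by blast

text \<open>The isomorphism with components identity, minus identity, identity flips the signs of
  the first two arrows.\<close>

lemma tri_neg:
  assumes "tri X Y W f g h"
  shows "tri X Y W (neg f) (neg g) h"
proof -
  note H = tri_Hom[OF assms]
  note i = Id_Hom[OF tri_Obj(2)[OF assms]]
  have "(neg f, neg g, h) \<in> Exact C"
  proof (rule TR1_iso[OF assms])
    show "is_triangle C X Y W (neg f, neg g, h)"
      using H neg_Hom by (simp add: is_triangle_def)
    show "is_iso C X X (Id C X)" "is_iso C Y Y (neg (Id C Y))" "is_iso C W W (Id C W)"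
      using is_iso_Id is_iso_neg_Id tri_Obj[OF assms] by auto
    show "neg (Id C Y) \<cdot> f = neg f \<cdot> Id C X"
      using neg_Comp[OF H(1) i] Id_Comp[OF H(1)] Comp_Id[OF neg_Hom[OF H(1)]] by simp
    show "Id C W \<cdot> g = neg g \<cdot> neg (Id C Y)"
      using Comp_neg[OF i neg_Hom[OF H(2)]] Id_Comp[OF H(2)] Comp_Id[OF neg_Hom[OF H(2)]]
        neg_neg[OF H(2)] by simp
    show "Shift C (Id C X) \<cdot> h = h \<cdot> Id C W"
      using Shift_Id tri_Obj[OF assms] Id_Comp[OF H(3)] Comp_Id[OF H(3)] by simp
  qed
  thus ?thesis
    using H neg_Hom by (simp add: is_exact_triangle_def is_triangle_def)
qed

text \<open>Three rotations put a minus sign on every arrow; \<open>tri_neg\<close> removes two of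
  them.\<close>

lemma shift_neg_iff:
  assumes "f \<in> Hom C X Y" "g \<in> Hom C Y W" "h \<in> Hom C W (S X)"
  shows "tri (S X) (S Y) (S W) (Sh f) (Sh g) (neg (Sh h)) \<longleftrightarrow> tri X Y W f g h"
  using shift_iff[OF assms] tri_neg[of "S X" "S Y" "S W"] neg_neg Sh_Hom assms by metis

lemma tri_Id: "\<lbrakk>X \<in> Obj C; is_zero_object C N\<rbrakk> \<Longrightarrow> tri X X N (Id C X) (Zero C X N) (Zero C N (S X))"
  using TR1_Id Id_Hom Zero_Hom S_Obj zero_object_Obj
  by (simp add: is_exact_triangle_def is_triangle_def)

lemma tri_Id_right:
  assumes "X \<in> Obj C" "is_zero_object C N"
  shows "tri N X X (Zero C N X) (Id C X) (Zero C X (S N))"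
proof -
  have N: "N \<in> Obj C" using assms zero_object_Obj by blast
  have "neg (Sh (Zero C N X)) = Zero C (S N) (S X)"
    using Sh_Zero neg_Zero S_Obj N assms by simp
  thus ?thesis
    using rotate_iff[OF Zero_Hom[OF N assms(1)]] tri_Id[OF assms(1), of "S N"] S_zero_iff[OF N] assms
    by simp
qed

text \<open>\<open>TR3\<close> maps the identity triangle \<open>X -> X -> N\<close> to the given
  one, which factors the composite through a zero object.\<close>

lemma tri_comp_zero:
  assumes "tri X Y W f g h"
  shows "g \<cdot> f = Zero C X W"
proof -
  note H = tri_Hom[OF assms]
  obtain N where N: "is_zero_object C N" using obtains_zero_object .
  obtain c where "c \<in> Hom C N W" "c \<cdot> Zero C X N = g \<cdot> f"
    using TR3[OF tri_Id[OF tri_Obj(1)[OF assms] N] assms Id_Hom H(1)] tri_Obj(1)[OF assms] by blast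
  thus ?thesis using Comp_Zero tri_Obj(1)[OF assms] by metis
qed

lemma tri_factor_right:
  assumes "tri X Y W f g h" "k \<in> Hom C Y T" "k \<cdot> f = Zero C X T"
  obtains k' where "k' \<in> Hom C W T" "k = k' \<cdot> g"
proof -
  note O = tri_Obj[OF assms(1)]
  obtain N where N: "is_zero_object C N" using obtains_zero_object .
  have T: "T \<in> Obj C" using Hom_Obj assms(2) by blast
  have "Zero C X N \<in> Hom C X N" using Zero_Hom O(1) N zero_object_Obj by blast
  moreover have "k \<cdot> f = Zero C N T \<cdot> Zero C X N"
    using assms(3) Comp_Zero[OF Zero_Hom] N T O zero_object_Obj by simp
  ultimately obtain c where "c \<in> Hom C W T" "c \<cdot> g = Id C T \<cdot> k"
    using TR3[OF assms(1) tri_Id_right[OF T N] _ assms(2)] by blast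
  thus ?thesis using that Id_Comp[OF assms(2)] by metis
qed

text \<open>\<open>TR3\<close> produces only the third component of a morphism of triangles. Both
  triangles are rotated so that the wanted arrow appears there shifted, and full faithfulness of the
  shift recovers it.\<close>

lemma tri_factor_left:
  assumes "tri X Y W f g h" "k \<in> Hom C T Y" "g \<cdot> k = Zero C T W"
  obtains k' where "k' \<in> Hom C T X" "k = f \<cdot> k'"
proof -
  note H = tri_Hom[OF assms(1)] and O = tri_Obj[OF assms(1)]
  obtain N where N: "is_zero_object C N" using obtains_zero_object .
  have T: "T \<in> Obj C" using Hom_Obj assms(2) by blast
  note IT = Id_Hom[OF T]
  have t: "tri T N (S T) (Zero C T N) (Zero C N (S T)) (neg (Sh (Id C T)))"
    using rotate[OF tri_Id[OF T N]] .
  have "Zero C N W \<in> Hom C N W" using Zero_Hom O(3) N zero_object_Obj by blast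
  moreover have "Zero C N W \<cdot> Zero C T N = g \<cdot> k"
    using assms(3) Comp_Zero[OF Zero_Hom] N T O zero_object_Obj by simp
  ultimately obtain c where c: "c \<in> Hom C (S T) (S X)" "Sh k \<cdot> neg (Sh (Id C T)) = neg (Sh f) \<cdot> c"
    using TR3[OF t rotate[OF assms(1)] assms(2)] by blast
  obtain k' where k': "k' \<in> Hom C T X" "c = Sh k'" using Sh_surj[OF c(1) T O(1)] .
  have "neg (Sh k) = neg (Sh (f \<cdot> k'))"
    using c(2) Comp_neg[OF Sh_Hom[OF IT] Sh_Hom[OF assms(2)]] neg_Comp[OF c(1) Sh_Hom[OF H(1)]]
      Shift_Comp[OF k'(1) H(1)] k'(2) Shift_Comp[OF IT assms(2)] Comp_Id[OF assms(2)] by simp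
  hence "k = f \<cdot> k'"
    using neg_inject Sh_inject Sh_Hom assms(2) Comp_Hom[OF k'(1) H(1)] by metis
  thus ?thesis using that k'(1) by blast
qed

lemma obtains_cone:
  assumes "f \<in> Hom C X Y"
  obtains W g h where "tri X Y W f g h"
  using TR1_cone[OF assms] by blast

lemma zero_objectI:
  assumes "X \<in> Obj C" "Hom C X X \<subseteq> {Zero C X X}"
  shows "is_zero_object C X"
  using assms Id_Hom zero_object_iff by blast

end

section \<open>Truncation at a phase\<close>

lemma K0_class_carrier: "X \<in> Obj C \<Longrightarrow> K0_class C X \<in> carrier (K0 C)"
  by (auto simp: K0_class_def K0_def FactGroup_def RCOSETS_def)

lemma (in triangulated_category) K0_class_add:
  assumes "tri X Y W f g h"
  shows "K0_class C Y = K0_class C X \<otimes>\<^bsub>K0 C\<^esub> K0_class C W"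
proof -
  define F where "F = free_Abelian_group (Obj C)"
  define R where "R = {frag_of Y - frag_of X - frag_of W | X Y W. \<exists>T. is_exact_triangle C X Y W T}"
  define N where "N = K0_relations C"
  interpret F: comm_group F unfolding F_def by (rule abelian_free_Abelian_group)
  have N_eq: "N = generate F R" by (simp add: N_def K0_relations_def F_def R_def)
  have carr: "frag_of X \<in> carrier F" if "X \<in> Obj C" for X using that by (simp add: F_def)
  have "R \<subseteq> carrier F"
  proof
    fix x assume "x \<in> R"
    then obtain X Y W T where *: "x = frag_of Y - frag_of X - frag_of W" "is_exact_triangle C X Y W T"
      unfolding R_def by blast
    obtain f g h where "T = (f, g, h)" by (cases T)
    hence O: "X \<in> Obj C" "Y \<in> Obj C" "W \<in> Obj C" using tri_Obj *(2) by blast+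
    have "x = frag_of Y \<otimes>\<^bsub>F\<^esub> inv\<^bsub>F\<^esub> frag_of X \<otimes>\<^bsub>F\<^esub> inv\<^bsub>F\<^esub> frag_of W"
      using *(1) O by (simp add: F_def)
    thus "x \<in> carrier F" using carr O by (metis F.inv_closed F.m_closed)
  qed
  hence sub: "subgroup N F" unfolding N_eq by (rule F.generate_is_subgroup)
  hence normal: "N \<lhd> F" by (simp add: F.normal_iff_subgroup)
  have cls: "K0_class C X = N #>\<^bsub>F\<^esub> frag_of X" for X by (simp add: K0_class_def N_def F_def)
  have K0: "K0 C = F Mod N" by (simp add: K0_def N_def F_def)
  note O = tri_Obj[OF assms]
  define r where "r = frag_of Y - frag_of X - frag_of W"
  have "r \<in> R" unfolding R_def r_def using assms by blast
  hence r: "r \<in> N" unfolding N_eq by (rule generate.incl)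
  have xw: "frag_of X \<otimes>\<^bsub>F\<^esub> frag_of W \<in> carrier F" using carr O by blast
  \<comment> \<open>The summand \<open>r\<close> is the defining relation of the triangle, so its
    coset is trivial.\<close>
  have "frag_of Y = r \<otimes>\<^bsub>F\<^esub> (frag_of X \<otimes>\<^bsub>F\<^esub> frag_of W)" by (simp add: F_def r_def)
  hence "N #>\<^bsub>F\<^esub> frag_of Y = (N #>\<^bsub>F\<^esub> r) #>\<^bsub>F\<^esub> (frag_of X \<otimes>\<^bsub>F\<^esub> frag_of W)"
    using F.coset_mult_assoc[OF subgroup.subset[OF sub] _ xw] subgroup.mem_carrier[OF sub r] by simp
  also have "\<dots> = N #>\<^bsub>F\<^esub> (frag_of X \<otimes>\<^bsub>F\<^esub> frag_of W)"
    using F.coset_join2[OF _ sub r] subgroup.mem_carrier[OF sub r] by simp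
  also have "\<dots> = K0_class C X \<otimes>\<^bsub>K0 C\<^esub> K0_class C W"
    using normal.rcos_sum[OF normal carr carr] O by (simp add: cls K0)
  finally show "K0_class C Y = K0_class C X \<otimes>\<^bsub>K0 C\<^esub> K0_class C W" by (simp add: cls)
qed

locale triangulated_stability = triangulated_category C + stability_condition C P Z
  for C (structure) and P and Z
begin

definition zeta :: "'a \<Rightarrow> complex" where
  "zeta X = Z (K0_class C X)"

text \<open>Defining both halves of the truncation by orthogonality makes their closure properties
  formal.\<close>

definition below :: "real \<Rightarrow> 'a set" where
  "below \<theta> = {X \<in> Obj C. \<forall>\<phi>>\<theta>. \<forall>Y \<in> P \<phi>. Hom C Y X \<subseteq> {Zero C Y X}}"

definition above :: "real \<Rightarrow> 'a set" where
  "above \<theta> = {X \<in> Obj C. \<forall>Y \<in> below \<theta>. Hom C X Y \<subseteq> {Zero C X Y}}"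

definition trunc :: "real \<Rightarrow> 'a \<Rightarrow> 'a \<Rightarrow> 'a \<Rightarrow> bool" where
  "trunc \<theta> X U V \<longleftrightarrow> U \<in> above \<theta> \<and> V \<in> below \<theta> \<and> (\<exists>f g h. tri U X V f g h)"

lemma zeta_tri:
  assumes "tri X Y W f g h"
  shows "zeta Y = zeta X + zeta W"
  using K0_class_add[OF assms] hom_mult[OF Z_hom, of "K0_class C X" "K0_class C W"]
    K0_class_carrier[OF tri_Obj(1)[OF assms]] K0_class_carrier[OF tri_Obj(3)[OF assms]]
  by (simp add: zeta_def complex_group_def)

lemma zeta_zero: "is_zero_object C N \<Longrightarrow> zeta N = 0"
  using zeta_tri[OF tri_Id[of N N]] zero_object_Obj by simp

lemma zeta_S:
  assumes "X \<in> Obj C"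
  shows "zeta (S X) = - zeta X"
proof -
  obtain N where N: "is_zero_object C N" using obtains_zero_object .
  show ?thesis
    using zeta_tri[OF rotate[OF tri_Id[OF assms N]]] zeta_zero[OF N] by (simp add: add_eq_0_iff)
qed

lemma P_Obj: "X \<in> P \<phi> \<Longrightarrow> X \<in> Obj C"
  using P_additive unfolding full_additive_subcategory_def by blast

lemma Hom_vanish_middle_right:
  assumes "tri X Y W f g h" "Hom C T X \<subseteq> {Zero C T X}" "Hom C T W \<subseteq> {Zero C T W}"
  shows "Hom C T Y \<subseteq> {Zero C T Y}"
proof
  fix k assume k: "k \<in> Hom C T Y"
  note H = tri_Hom[OF assms(1)]
  have "g \<cdot> k = Zero C T W" using Comp_Hom[OF k H(2)] assms(3) by blast
  then obtain k' where "k' \<in> Hom C T X" "k = f \<cdot> k'" using tri_factor_left[OF assms(1) k] by blast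
  thus "k \<in> {Zero C T Y}" using assms(2) Comp_Zero[OF H(1)] Hom_Obj[OF k] by blast
qed

lemma Hom_vanish_middle_left:
  assumes "tri X Y W f g h" "Hom C X T \<subseteq> {Zero C X T}" "Hom C W T \<subseteq> {Zero C W T}"
  shows "Hom C Y T \<subseteq> {Zero C Y T}"
proof
  fix k assume k: "k \<in> Hom C Y T"
  note H = tri_Hom[OF assms(1)]
  have "k \<cdot> f = Zero C X T" using Comp_Hom[OF H(1) k] assms(2) by blast
  then obtain k' where "k' \<in> Hom C W T" "k = k' \<cdot> g" using tri_factor_right[OF assms(1) k] by blast
  thus "k \<in> {Zero C Y T}" using assms(3) Zero_Comp[OF H(2)] Hom_Obj[OF k] by blast
qed

lemma below_Obj: "X \<in> below \<theta> \<Longrightarrow> X \<in> Obj C"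
  by (simp add: below_def)

lemma above_Obj: "X \<in> above \<theta> \<Longrightarrow> X \<in> Obj C"
  by (simp add: above_def)

lemma below_ext: "\<lbrakk>tri X Y W f g h; X \<in> below \<theta>; W \<in> below \<theta>\<rbrakk> \<Longrightarrow> Y \<in> below \<theta>"
  using Hom_vanish_middle_right[of X Y W f g h] tri_Obj(2)[of X Y W f g h]
  unfolding below_def by blast

lemma above_ext: "\<lbrakk>tri X Y W f g h; X \<in> above \<theta>; W \<in> above \<theta>\<rbrakk> \<Longrightarrow> Y \<in> above \<theta>"
  using Hom_vanish_middle_left[of X Y W f g h] tri_Obj(2)[of X Y W f g h]
  unfolding above_def by blast

lemma Hom_S_vanish_iff:
  assumes "X \<in> Obj C" "Y \<in> Obj C"
  shows "Hom C (S X) (S Y) \<subseteq> {Zero C (S X) (S Y)} \<longleftrightarrow> Hom C X Y \<subseteq> {Zero C X Y}"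
proof
  assume *: "Hom C (S X) (S Y) \<subseteq> {Zero C (S X) (S Y)}"
  show "Hom C X Y \<subseteq> {Zero C X Y}"
  proof
    fix k assume k: "k \<in> Hom C X Y"
    hence "Sh k = Sh (Zero C X Y)" using * Sh_Hom[OF k] Sh_Zero[OF assms] by auto
    thus "k \<in> {Zero C X Y}" using Sh_inject[OF k Zero_Hom] assms by simp
  qed
next
  assume *: "Hom C X Y \<subseteq> {Zero C X Y}"
  show "Hom C (S X) (S Y) \<subseteq> {Zero C (S X) (S Y)}"
    using Sh_surj[OF _ assms] * Sh_Zero[OF assms] by blast
qed

lemma below_S_iff:
  assumes "X \<in> Obj C"
  shows "S X \<in> below (\<theta> + 1) \<longleftrightarrow> X \<in> below \<theta>"
proof
  assume *: "S X \<in> below (\<theta> + 1)"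
  have "Hom C Y X \<subseteq> {Zero C Y X}" if "\<phi> > \<theta>" "Y \<in> P \<phi>" for \<phi> Y
  proof -
    have "S Y \<in> P (\<phi> + 1)" "\<phi> + 1 > \<theta> + 1" using that P_Shift by auto
    hence "Hom C (S Y) (S X) \<subseteq> {Zero C (S Y) (S X)}" using * unfolding below_def by blast
    thus ?thesis using Hom_S_vanish_iff[OF P_Obj[OF that(2)] assms] by blast
  qed
  thus "X \<in> below \<theta>" using assms by (auto simp: below_def)
next
  assume *: "X \<in> below \<theta>"
  have "Hom C Y (S X) \<subseteq> {Zero C Y (S X)}" if "\<phi> > \<theta> + 1" "Y \<in> P \<phi>" for \<phi> Y
  proof -
    have "Y \<in> S ` P (\<phi> - 1)" using that P_Shift[of "\<phi> - 1"] by simp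
    then obtain Y' where Y': "Y' \<in> P (\<phi> - 1)" "Y = S Y'" by blast
    moreover have "\<phi> - 1 > \<theta>" using that by simp
    ultimately show ?thesis
      using * Hom_S_vanish_iff[OF P_Obj[OF Y'(1)] assms] unfolding below_def by blast
  qed
  thus "S X \<in> below (\<theta> + 1)" using S_Obj[OF assms] by (auto simp: below_def)
qed

lemma above_S:
  assumes "X \<in> above \<theta>"
  shows "S X \<in> above (\<theta> + 1)"
proof -
  have X: "X \<in> Obj C" using assms above_Obj by blast
  have "Hom C (S X) Y \<subseteq> {Zero C (S X) Y}" if Y: "Y \<in> below (\<theta> + 1)" for Y
  proof -
    obtain Y' where Y': "Y' \<in> Obj C" "Y = S Y'" using S_surj[OF below_Obj[OF Y]] .
    thus ?thesis
      using Y assms Hom_S_vanish_iff[OF X Y'(1)] below_S_iff[OF Y'(1)] unfolding above_def by blast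
  qed
  thus ?thesis using S_Obj[OF X] by (auto simp: above_def)
qed

lemma below_mono: "\<lbrakk>X \<in> below \<theta>; \<theta> \<le> \<theta>'\<rbrakk> \<Longrightarrow> X \<in> below \<theta>'"
  unfolding below_def by (blast intro: le_less_trans)

lemma above_antimono: "\<lbrakk>X \<in> above \<theta>'; \<theta> \<le> \<theta>'\<rbrakk> \<Longrightarrow> X \<in> above \<theta>"
  using below_mono unfolding above_def by blast

lemma P_above: "\<lbrakk>X \<in> P \<phi>; \<theta> < \<phi>\<rbrakk> \<Longrightarrow> X \<in> above \<theta>"
  using P_Obj unfolding above_def below_def by blast

lemma P_below: "\<lbrakk>X \<in> P \<phi>; \<phi> \<le> \<theta>\<rbrakk> \<Longrightarrow> X \<in> below \<theta>"
  unfolding below_def using P_Obj P_Hom le_less_trans equalityD1 by blast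

lemma zero_below: "is_zero_object C N \<Longrightarrow> N \<in> below \<theta>"
  unfolding below_def using Hom_to_zero zero_object_Obj by blast

lemma zero_above: "is_zero_object C N \<Longrightarrow> N \<in> above \<theta>"
  unfolding above_def using Hom_from_zero zero_object_Obj by blast

lemma above_below_zero: "\<lbrakk>X \<in> above \<theta>; X \<in> below \<theta>\<rbrakk> \<Longrightarrow> is_zero_object C X"
  using zero_objectI above_Obj unfolding above_def by blast

text \<open>\<open>W\<close> is an extension of \<open>S X\<close> by \<open>Y\<close>, and
  \<open>S X\<close> even lies above \<open>\<theta> + 1\<close>.\<close>

lemma above_cone:
  assumes "tri X Y W f g h" "X \<in> above \<theta>" "Y \<in> above \<theta>"
  shows "W \<in> above \<theta>"
  using above_ext[OF rotate[OF assms(1)] assms(3)] above_antimono[OF above_S[OF assms(2)]] by simp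

text \<open>Rotation puts \<open>S X\<close> between \<open>W\<close> and \<open>S Y\<close>. Both
  lie below \<open>\<theta> + 1\<close>, and unshifting gives the bound for
  \<open>X\<close>.\<close>

lemma below_fibre:
  assumes "tri X Y W f g h" "Y \<in> below \<theta>" "W \<in> below \<theta>"
  shows "X \<in> below \<theta>"
proof -
  have "S Y \<in> below (\<theta> + 1)" using below_S_iff assms(2) below_Obj by blast
  moreover have "W \<in> below (\<theta> + 1)" using below_mono assms(3) by simp
  ultimately have "S X \<in> below (\<theta> + 1)" using below_ext[OF rotate[OF rotate[OF assms(1)]]] by blast
  thus ?thesis using below_S_iff tri_Obj[OF assms(1)] by blast
qed

text \<open>The map \<open>U -> X\<close> lifts through \<open>U'\<close> because its composite to
  \<open>V'\<close> vanishes; the lift has zero cone, so the central charges agree.\<close>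

lemma trunc_unique:
  assumes "trunc \<theta> X U V" "trunc \<theta> X U' V'"
  shows "zeta U = zeta U'"
proof -
  obtain f g h where t: "tri U X V f g h" and UV: "U \<in> above \<theta>" "V \<in> below \<theta>"
    using assms(1) unfolding trunc_def by blast
  obtain f' g' h' where t': "tri U' X V' f' g' h'" and UV': "U' \<in> above \<theta>" "V' \<in> below \<theta>"
    using assms(2) unfolding trunc_def by blast
  have "g' \<cdot> f \<in> Hom C U V'" using Comp_Hom tri_Hom t t' by blast
  hence "g' \<cdot> f = Zero C U V'" using UV UV' unfolding above_def by blast
  then obtain k where k: "k \<in> Hom C U U'" "f = f' \<cdot> k"
    using tri_factor_left[OF t' tri_Hom(1)[OF t]] by blast
  \<comment> \<open>The cone \<open>D\<close> lies both above and below \<open>\<theta>\<close>, so it vanishes.\<close>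
  obtain D p d where c: "tri U U' D k p d" using obtains_cone[OF k(1)] .
  obtain a b where "tri D V V' a b (Sh p \<cdot> h')" using TR4[OF c _ t'] t k(2) by blast
  hence "D \<in> below \<theta>" using below_fibre UV UV' by blast
  moreover have "D \<in> above \<theta>" using above_cone[OF c] UV UV' by blast
  ultimately have "zeta D = 0" using above_below_zero zeta_zero by blast
  thus ?thesis using zeta_tri[OF c] by simp
qed

text \<open>Extending \<open>X\<close> by an object below \<theta> keeps its upper part: by the
  octahedral axiom the cone of \<open>U -> Y\<close> is an extension of \<open>W\<close> by
  \<open>V\<close>.\<close>

lemma trunc_extend:
  assumes "trunc \<theta> X U V" "tri X Y W f g h" "W \<in> below \<theta>"
  obtains R where "trunc \<theta> Y U R"
proof -
  obtain f' g' h' where t: "tri U X V f' g' h'" and UV: "U \<in> above \<theta>" "V \<in> below \<theta>"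
    using assms(1) unfolding trunc_def by blast
  obtain R p d where c: "tri U Y R (f \<cdot> f') p d"
    using obtains_cone[OF Comp_Hom[OF tri_Hom(1)[OF t] tri_Hom(1)[OF assms(2)]]] .
  obtain a b where "tri V R W a b (Sh g' \<cdot> h)" using TR4[OF t c assms(2)] by blast
  hence "R \<in> below \<theta>" using below_ext UV assms(3) by blast
  thus ?thesis using that c UV unfolding trunc_def by blast
qed

lemma trunc_S:
  assumes "trunc \<theta> X U V"
  shows "trunc (\<theta> + 1) (S X) (S U) (S V)"
proof -
  obtain f g h where t: "tri U X V f g h" and UV: "U \<in> above \<theta>" "V \<in> below \<theta>"
    using assms(1) unfolding trunc_def by blast
  show ?thesis
    unfolding trunc_def
    using above_S UV below_S_iff[OF below_Obj] rotate[OF rotate[OF rotate[OF t]]] by blast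
qed

section \<open>Truncations read off from Harder-Narasimhan filtrations\<close>

lemma HN_exists:
  assumes "X \<in> Obj C"
  obtains n Y \<phi> where "HN_filtration C P X n Y \<phi>"
proof (cases "is_zero_object C X")
  case True
  hence "HN_filtration C P X 0 Y \<phi>" for Y \<phi> unfolding HN_filtration_def by auto
  thus ?thesis using that by blast
next
  case False
  thus ?thesis using that P_HN assms by blast
qed

text \<open>Phases decrease, so the factors of phase above \<theta> form an initial segment; the
  filtration step at its end serves as \<open>U\<close>.\<close>

lemma HN_truncation:
  assumes "HN_filtration C P X n Y \<phi>"
  obtains U V where "trunc \<theta> X U V" "zeta U = (\<Sum>i | i < n \<and> \<phi> i > \<theta>. zeta (Y i))"
    "zeta X = (\<Sum>i<n. zeta (Y i))"
proof -
  obtain F where F: "is_zero_object C (F 0)" "F n = X"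
    and T: "\<And>i. i < n \<Longrightarrow> \<exists>f g h. tri (F i) (F (Suc i)) (Y i) f g h"
    and Y: "\<And>i. i < n \<Longrightarrow> Y i \<in> P (\<phi> i)" and dec: "\<And>i j. i < j \<Longrightarrow> j < n \<Longrightarrow> \<phi> j < \<phi> i"
    using assms unfolding HN_filtration_def by (metis prod_cases3)
  have zeta_F: "zeta (F j) = (\<Sum>i<j. zeta (Y i))" if "j \<le> n" for j
    using that
  proof (induction j)
    case 0 thus ?case using zeta_zero F by simp
  next
    case (Suc j)
    then obtain f g h where "tri (F j) (F (Suc j)) (Y j) f g h" using T[of j] by auto
    thus ?case using zeta_tri Suc by simp
  qed
  have F_Obj: "F j \<in> Obj C" if "j \<le> n" for j
  proof (cases j)
    case 0 thus ?thesis using F(1) zero_object_Obj by simp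
  next
    case (Suc i)
    then obtain f g h where "tri (F i) (F j) (Y i) f g h" using T[of i] \<open>j \<le> n\<close> by auto
    thus ?thesis by (rule tri_Obj(2))
  qed
  \<comment> \<open>The alternative \<open>n \<le> j\<close> yields \<open>k = n\<close> when all
    phases exceed \<theta>.\<close>
  define k where "k = (LEAST j. n \<le> j \<or> \<phi> j \<le> \<theta>)"
  have k: "n \<le> k \<or> \<phi> k \<le> \<theta>" unfolding k_def by (rule LeastI_ex) blast
  have k_le: "k \<le> n" unfolding k_def by (rule Least_le) simp
  have lt_k: "\<phi> i > \<theta>" if "i < k" for i
    using that not_less_Least[of i "\<lambda>j. n \<le> j \<or> \<phi> j \<le> \<theta>"] unfolding k_def by auto
  have ge_k: "\<phi> i \<le> \<theta>" if "k \<le> i" "i < n" for i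
    using that k dec[of k i] by (cases "i = k") force+
  have set: "{i. i < n \<and> \<phi> i > \<theta>} = {..<k}"
  proof (intro equalityI subsetI)
    fix i assume "i \<in> {i. i < n \<and> \<phi> i > \<theta>}"
    thus "i \<in> {..<k}" using ge_k[of i] by force
  qed (use lt_k k_le in auto)
  have U: "F j \<in> above \<theta>" if "j \<le> k" for j
    using that
  proof (induction j)
    case 0 thus ?case using zero_above F by simp
  next
    case (Suc j)
    have "Y j \<in> above \<theta>" using P_above[OF Y[of j] lt_k[of j]] Suc k_le by simp
    moreover have "F j \<in> above \<theta>" using Suc by simp
    moreover obtain f g h where "tri (F j) (F (Suc j)) (Y j) f g h" using T[of j] Suc k_le by auto
    ultimately show ?case using above_ext by blast
  qed
  \<comment> \<open>Octahedra over \<open>F k -> F j -> F (Suc j)\<close> build the cone of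
    \<open>F k -> F n\<close> from the factors of phase at most \<theta>.\<close>
  have "\<exists>V f g h. V \<in> below \<theta> \<and> tri (F k) (F j) V f g h" if "k \<le> j" "j \<le> n" for j
    using that
  proof (induction j rule: dec_induct)
    case base
    obtain N where "is_zero_object C N" using obtains_zero_object .
    thus ?case using tri_Id[OF F_Obj[OF k_le]] zero_below by blast
  next
    case (step j)
    then obtain V f g h where V: "V \<in> below \<theta>" "tri (F k) (F j) V f g h" by auto
    obtain f' g' h' where t: "tri (F j) (F (Suc j)) (Y j) f' g' h'" using T[of j] step by auto
    have Yj: "Y j \<in> below \<theta>" using P_below[OF Y[of j] ge_k[of j]] step by simp
    obtain R p d where c: "tri (F k) (F (Suc j)) R (f' \<cdot> f) p d"
      using obtains_cone[OF Comp_Hom[OF tri_Hom(1)[OF V(2)] tri_Hom(1)[OF t]]] .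
    show ?case using TR4[OF V(2) c t] below_ext V(1) Yj c by blast
  qed
  from this[of n] obtain V f g h where V: "V \<in> below \<theta>" "tri (F k) X V f g h" using k_le F by auto
  have "trunc \<theta> X (F k) V" using V U[of k] unfolding trunc_def by blast
  thus ?thesis using that zeta_F[OF k_le] zeta_F[of n] F(2) set by simp
qed

lemma trunc_exists:
  assumes "X \<in> Obj C"
  obtains U V where "trunc \<theta> X U V"
proof -
  obtain n Y \<phi> where "HN_filtration C P X n Y \<phi>" using HN_exists[OF assms] .
  thus ?thesis using HN_truncation[of X n Y \<phi> \<theta>] that by blast
qed

end

section \<open>Mass\<close>

text \<open>The rotation turns the ray of phase \<theta> into the positive real axis, so phases
  strictly between \<theta> and \<open>\<theta> + 1\<close> have positive height.\<close>

definition height :: "real \<Rightarrow> complex \<Rightarrow> real" where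
  "height \<theta> z = Im (z * cis (- (pi * \<theta>)))"

lemma height_add: "height \<theta> (z + w) = height \<theta> z + height \<theta> w"
  by (simp add: height_def algebra_simps)

lemma height_sum: "height \<theta> (\<Sum>i\<in>I. z i) = (\<Sum>i\<in>I. height \<theta> (z i))"
  by (simp add: height_def sum_distrib_right)

lemma height_minus: "height \<theta> (- z) = - height \<theta> z"
  by (simp add: height_def)

lemma polar_rotate:
  "of_real r * cis (pi * \<phi>) * cis (- (pi * \<theta>)) = of_real r * cis (pi * (\<phi> - \<theta>))"
  unfolding mult.assoc cis_mult by (simp add: right_diff_distrib)

lemma height_polar: "height \<theta> (of_real r * cis (pi * \<phi>)) = r * sin (pi * (\<phi> - \<theta>))"
  unfolding height_def polar_rotate by simp

text \<open>Left of \<phi> an antiderivative is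
  \<open>r * cos (pi * (\<phi> - \<theta>)) / pi\<close>; from \<phi> on the integrand is
  zero.\<close>

lemma has_integral_sin_tail:
  fixes a b r \<phi> :: real
  assumes "a \<le> \<phi>" "\<phi> \<le> b"
  shows "((\<lambda>\<theta>. if \<theta> < \<phi> then r * sin (pi * (\<phi> - \<theta>)) else 0)
    has_integral (r - r * cos (pi * (\<phi> - a))) / pi) {a..b}"
proof -
  let ?g = "\<lambda>\<theta>. if \<theta> < \<phi> then r * sin (pi * (\<phi> - \<theta>)) else 0"
  have "((\<lambda>\<theta>. r * sin (pi * (\<phi> - \<theta>))) has_integral
      r * cos (pi * (\<phi> - \<phi>)) / pi - r * cos (pi * (\<phi> - a)) / pi) {a..\<phi>}"
    by (intro fundamental_theorem_of_calculus[OF assms(1)])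
      (auto simp flip: has_real_derivative_iff_has_vector_derivative intro!: derivative_eq_intros)
  hence "(?g has_integral (r - r * cos (pi * (\<phi> - a))) / pi) {a..\<phi>}"
    by (rule has_integral_eq_rhs[OF has_integral_eq[rotated]]) (auto simp: diff_divide_distrib)
  moreover have "(?g has_integral 0) {\<phi>..b}"
    by (rule has_integral_is_0) auto
  ultimately show ?thesis
    using has_integral_combine[OF assms, of ?g] by fastforce
qed

context triangulated_stability
begin

abbreviation m :: "'a \<Rightarrow> real" where "m \<equiv> mass C P Z"

text \<open>This is \<open>u\<^sub>\<theta>(X)\<close>; by \<open>trunc_unique\<close> the choice of \<open>U\<close> does not matter.\<close>

definition upper :: "real \<Rightarrow> 'a \<Rightarrow> real" where
  "upper \<theta> X = height \<theta> (zeta (SOME U. \<exists>V. trunc \<theta> X U V))"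

lemma upper_eq:
  assumes "trunc \<theta> X U V"
  shows "upper \<theta> X = height \<theta> (zeta U)"
proof -
  have "\<exists>V. trunc \<theta> X (SOME U. \<exists>V. trunc \<theta> X U V) V"
    using assms by (intro someI_ex[of "\<lambda>U. \<exists>V. trunc \<theta> X U V"]) blast
  thus ?thesis using trunc_unique[OF assms] unfolding upper_def by auto
qed

lemma zeta_semistable:
  assumes "A \<in> P \<phi>" "\<not> is_zero_object C A"
  shows "zeta A = of_real (cmod (zeta A)) * cis (pi * \<phi>)"
proof -
  obtain r where "r > 0" "zeta A = of_real r * cis (pi * \<phi>)"
    using Z_phase[OF assms] by (auto simp: zeta_def cis_conv_exp)
  thus ?thesis by (simp add: norm_mult)
qed

lemma height_semistable:
  assumes "A \<in> P \<phi>" "\<not> is_zero_object C A"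
  shows "height \<theta> (zeta A) = cmod (zeta A) * sin (pi * (\<phi> - \<theta>))"
  by (subst zeta_semistable[OF assms]) (rule height_polar)

text \<open>Each factor contributes one sine tail, and the cosine terms add up to the real part of
  the rotated central charge. The integrand and this real part do not mention the filtration, hence
  the sum of moduli does not depend on it.\<close>

lemma HN_integral:
  assumes "HN_filtration C P X n Y \<phi>" "\<And>i. i < n \<Longrightarrow> a \<le> \<phi> i" "\<And>i. i < n \<Longrightarrow> \<phi> i \<le> b"
  shows "((\<lambda>\<theta>. upper \<theta> X) has_integral
    ((\<Sum>i<n. cmod (zeta (Y i))) - Re (zeta X * cis (- (pi * a)))) / pi) {a..b}"
proof -
  have Y: "Y i \<in> P (\<phi> i)" "\<not> is_zero_object C (Y i)" if "i < n" for i
    using assms(1) that unfolding HN_filtration_def by auto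
  have "upper \<theta> X = (\<Sum>i<n. if \<theta> < \<phi> i then cmod (zeta (Y i)) * sin (pi * (\<phi> i - \<theta>)) else 0)" for \<theta>
  proof -
    obtain U V where UV: "trunc \<theta> X U V" "zeta U = (\<Sum>i | i < n \<and> \<phi> i > \<theta>. zeta (Y i))"
      using HN_truncation[OF assms(1)] .
    have "upper \<theta> X = (\<Sum>i | i < n \<and> \<phi> i > \<theta>. height \<theta> (zeta (Y i)))"
      using upper_eq[OF UV(1)] UV(2) height_sum by simp
    also have "\<dots> = (\<Sum>i | i \<in> {..<n} \<and> \<theta> < \<phi> i. cmod (zeta (Y i)) * sin (pi * (\<phi> i - \<theta>)))"
      using height_semistable[OF Y] by (intro sum.cong) auto
    also have "\<dots> = (\<Sum>i<n. if \<theta> < \<phi> i then cmod (zeta (Y i)) * sin (pi * (\<phi> i - \<theta>)) else 0)"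
      by (rule sum.inter_filter) simp
    finally show ?thesis .
  qed
  moreover have "((\<Sum>i<n. cmod (zeta (Y i))) - Re (zeta X * cis (- (pi * a)))) / pi =
      (\<Sum>i<n. (cmod (zeta (Y i)) - cmod (zeta (Y i)) * cos (pi * (\<phi> i - a))) / pi)"
  proof -
    have "zeta X = (\<Sum>i<n. zeta (Y i))"
      using HN_truncation[OF assms(1)] by blast
    also have "\<dots> = (\<Sum>i<n. of_real (cmod (zeta (Y i))) * cis (pi * \<phi> i))"
      using zeta_semistable[OF Y] by (intro sum.cong) auto
    finally have "zeta X * cis (- (pi * a)) =
        (\<Sum>i<n. of_real (cmod (zeta (Y i))) * cis (pi * (\<phi> i - a)))"
      by (simp only: sum_distrib_right polar_rotate)
    hence "Re (zeta X * cis (- (pi * a))) = (\<Sum>i<n. cmod (zeta (Y i)) * cos (pi * (\<phi> i - a)))"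
      by simp
    thus ?thesis by (simp add: sum_subtractf sum_divide_distrib diff_divide_distrib)
  qed
  ultimately show ?thesis
    using assms(2,3) by (auto intro!: has_integral_sum has_integral_sin_tail)
qed

section \<open>Well-definedness of the mass and its integral formula\<close>

lemma bounded_initial_segment:
  fixes \<phi> :: "nat \<Rightarrow> real"
  obtains c where "\<And>i. i < n \<Longrightarrow> \<bar>\<phi> i\<bar> \<le> c"
proof -
  have "\<bar>\<phi> i\<bar> \<le> (\<Sum>i<n. \<bar>\<phi> i\<bar>)" if "i < n" for i
    using member_le_sum[of i "{..<n}" "\<lambda>i. \<bar>\<phi> i\<bar>"] that by simp
  thus ?thesis using that by blast
qed

text \<open>Two filtrations of \<open>X\<close> compute the same integral over an interval
  containing all phases of both, so uniqueness of integrals stands in for uniqueness of the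
  filtration up to isomorphism.\<close>

lemma HN_mass:
  assumes "HN_filtration C P X n Y \<phi>"
  shows "m X = (\<Sum>i<n. cmod (zeta (Y i)))"
proof -
  have unique: "(\<Sum>i<k. cmod (zeta (Y' i))) = (\<Sum>i<n. cmod (zeta (Y i)))"
    if *: "HN_filtration C P X k Y' \<psi>" for k Y' \<psi>
  proof -
    obtain c where c: "\<And>i. i < n \<Longrightarrow> \<bar>\<phi> i\<bar> \<le> c" using bounded_initial_segment[of n \<phi>] by blast
    obtain d where d: "\<And>i. i < k \<Longrightarrow> \<bar>\<psi> i\<bar> \<le> d" using bounded_initial_segment[of k \<psi>] by blast
    define e where "e = max c d"
    have "\<And>i. i < n \<Longrightarrow> - e \<le> \<phi> i \<and> \<phi> i \<le> e" "\<And>i. i < k \<Longrightarrow> - e \<le> \<psi> i \<and> \<psi> i \<le> e"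
      using c d unfolding e_def by fastforce+
    thus ?thesis
      using has_integral_unique[OF HN_integral[OF assms, of "- e" e] HN_integral[OF *, of "- e" e]]
      by simp
  qed
  show ?thesis
  proof (cases "is_zero_object C X")
    case True
    hence "HN_filtration C P X 0 Y \<phi>" unfolding HN_filtration_def by auto
    thus ?thesis using unique[of 0] True by (simp add: mass_def)
  next
    case False
    have "(THE r. \<exists>n Y \<phi>. HN_filtration C P X n Y \<phi> \<and> r = (\<Sum>i<n. cmod (Z (K0_class C (Y i)))))
        = (\<Sum>i<n. cmod (zeta (Y i)))"
      using assms unique unfolding zeta_def by (intro the_equality) blast+
    thus ?thesis using False by (simp add: mass_def)
  qed
qed

text \<open>Validity for all large \<open>c\<close> lets several objects share one interval.\<close>

lemma mass_integral:
  assumes "X \<in> Obj C"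
  shows "\<forall>\<^sub>F c in at_top.
    ((\<lambda>\<theta>. upper \<theta> X) has_integral (m X - Re (zeta X * cis (pi * c))) / pi) {- c..c}"
proof -
  obtain n Y \<phi> where HN: "HN_filtration C P X n Y \<phi>" using HN_exists[OF assms] .
  obtain c0 where c0: "\<And>i. i < n \<Longrightarrow> \<bar>\<phi> i\<bar> \<le> c0" using bounded_initial_segment[of n \<phi>] by blast
  have "((\<lambda>\<theta>. upper \<theta> X) has_integral (m X - Re (zeta X * cis (pi * c))) / pi) {- c..c}"
    if "c \<ge> c0" for c
  proof -
    have "- c \<le> \<phi> i" "\<phi> i \<le> c" if "i < n" for i using c0[OF that] \<open>c \<ge> c0\<close> by auto
    thus ?thesis using HN_integral[OF HN, of "- c" c] HN_mass[OF HN] by simp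
  qed
  thus ?thesis unfolding eventually_at_top_linorder by blast
qed

text \<open>Additivity of \<open>zeta\<close> makes the two boundary terms equal, so comparing the
  integrands compares the masses.\<close>

lemma mass_integrals:
  assumes "X \<in> Obj C" "Y \<in> Obj C" "W \<in> Obj C" "zeta Y = zeta X + zeta W"
  obtains c where
    "((\<lambda>\<theta>. upper \<theta> Y) has_integral (m Y - Re (zeta Y * cis (pi * c))) / pi) {- c..c}"
    "((\<lambda>\<theta>. upper \<theta> X + upper \<theta> W) has_integral (m X + m W - Re (zeta Y * cis (pi * c))) / pi) {- c..c}"
proof -
  have "\<forall>\<^sub>F c in at_top.
    ((\<lambda>\<theta>. upper \<theta> X) has_integral (m X - Re (zeta X * cis (pi * c))) / pi) {- c..c} \<and>
    ((\<lambda>\<theta>. upper \<theta> Y) has_integral (m Y - Re (zeta Y * cis (pi * c))) / pi) {- c..c} \<and>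
    ((\<lambda>\<theta>. upper \<theta> W) has_integral (m W - Re (zeta W * cis (pi * c))) / pi) {- c..c}"
    by (intro eventually_conj mass_integral assms)
  then obtain c where
    cX: "((\<lambda>\<theta>. upper \<theta> X) has_integral (m X - Re (zeta X * cis (pi * c))) / pi) {- c..c}" and
    cY: "((\<lambda>\<theta>. upper \<theta> Y) has_integral (m Y - Re (zeta Y * cis (pi * c))) / pi) {- c..c}" and
    cW: "((\<lambda>\<theta>. upper \<theta> W) has_integral (m W - Re (zeta W * cis (pi * c))) / pi) {- c..c}"
    using eventually_happens[of _ "at_top :: real filter"] by auto
  have "(m X - Re (zeta X * cis (pi * c))) / pi + (m W - Re (zeta W * cis (pi * c))) / pi
      = (m X + m W - Re (zeta Y * cis (pi * c))) / pi"
    unfolding assms(4) distrib_right plus_complex.sel by argo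
  thus ?thesis using that[of c] cY has_integral_add[OF cX cW] by simp
qed

text \<open>The factors of \<open>K\<close> lost by truncating at \<open>\<theta> + 1\<close> have phase in \<open>(\<theta>, \<theta> + 1]\<close>, hence
  non-negative height.\<close>

lemma height_above:
  assumes "K \<in> above \<theta>" "trunc (\<theta> + 1) K U V"
  shows "height \<theta> (zeta U) \<le> height \<theta> (zeta K)"
proof -
  obtain n Y \<phi> where HN: "HN_filtration C P K n Y \<phi>" using HN_exists[OF above_Obj[OF assms(1)]] .
  have Y: "Y i \<in> P (\<phi> i)" "\<not> is_zero_object C (Y i)" if "i < n" for i
    using HN that unfolding HN_filtration_def by auto
  obtain U1 V1 where 1: "trunc (\<theta> + 1) K U1 V1" "zeta U1 = (\<Sum>i | i < n \<and> \<phi> i > \<theta> + 1. zeta (Y i))"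
    using HN_truncation[OF HN] .
  obtain U0 V0 where 0: "trunc \<theta> K U0 V0" "zeta U0 = (\<Sum>i | i < n \<and> \<phi> i > \<theta>. zeta (Y i))"
    using HN_truncation[OF HN] .
  obtain f g h where t: "tri U0 K V0 f g h" and UV0: "U0 \<in> above \<theta>" "V0 \<in> below \<theta>"
    using 0(1) unfolding trunc_def by blast
  \<comment> \<open>\<open>V0\<close> is the cone of a map between objects above \<theta>, and it
    also lies below \<theta>.\<close>
  have "is_zero_object C V0"
    using above_below_zero above_cone[OF t UV0(1) assms(1)] UV0(2) by blast
  hence "zeta K = zeta U0" using zeta_tri[OF t] zeta_zero by simp
  moreover have "zeta U = zeta U1" using trunc_unique[OF assms(2) 1(1)] .
  moreover have "height \<theta> (zeta U1) \<le> height \<theta> (zeta U0)"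
    unfolding 0(2) 1(2) height_sum
  proof (rule sum_mono2)
    fix i assume "i \<in> {i. i < n \<and> \<theta> < \<phi> i} - {i. i < n \<and> \<theta> + 1 < \<phi> i}"
    hence i: "i < n" "0 \<le> pi * (\<phi> i - \<theta>)" "pi * (\<phi> i - \<theta>) \<le> pi" by auto
    thus "0 \<le> height \<theta> (zeta (Y i))"
      using height_semistable[OF Y[OF i(1)]] sin_ge_zero by simp
  qed auto
  ultimately show ?thesis by simp
qed

text \<open>With \<open>K\<close> the cone of a map \<open>UB -> UD\<close> over \<open>g\<close>,
  the part of \<open>K\<close> above \<open>\<theta> + 1\<close> has central charge
  \<open>- zeta UA\<close>. By \<open>height_above\<close>, the height of \<open>UD\<close> minus
  that of \<open>UB\<close> is at least minus that of \<open>UA\<close>.\<close>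

lemma upper_subadditive:
  assumes t: "tri A B D f g h"
  shows "upper \<theta> B \<le> upper \<theta> A + upper \<theta> D"
proof -
  obtain UA VA where A: "trunc \<theta> A UA VA" using trunc_exists tri_Obj[OF t] by blast
  obtain UB VB where B: "trunc \<theta> B UB VB" using trunc_exists tri_Obj[OF t] by blast
  obtain UD VD where D: "trunc \<theta> D UD VD" using trunc_exists tri_Obj[OF t] by blast
  obtain b1 b2 b3 where tB: "tri UB B VB b1 b2 b3" and UVB: "UB \<in> above \<theta>" "VB \<in> below \<theta>"
    using B unfolding trunc_def by blast
  obtain d1 d2 d3 where tD: "tri UD D VD d1 d2 d3" and UVD: "UD \<in> above \<theta>" "VD \<in> below \<theta>"
    using D unfolding trunc_def by blast
  have gb: "g \<cdot> b1 \<in> Hom C UB D" using Comp_Hom tri_Hom t tB by blast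
  hence "d2 \<cdot> (g \<cdot> b1) \<in> Hom C UB VD" using Comp_Hom tri_Hom tD by blast
  hence "d2 \<cdot> (g \<cdot> b1) = Zero C UB VD" using UVB UVD unfolding above_def by blast
  then obtain k where k: "k \<in> Hom C UB UD" "g \<cdot> b1 = d1 \<cdot> k"
    using tri_factor_left[OF tD gb] by blast
  \<comment> \<open>Two octahedra over the square \<open>UB \<rightarrow> B \<rightarrow> D\<close>, \<open>UB \<rightarrow> UD \<rightarrow> D\<close> and a third one show that \<open>S A\<close> and
    the cone \<open>K\<close> of \<open>UB \<rightarrow> UD\<close> have the same part above \<open>\<theta> + 1\<close>.\<close>
  obtain W w1 w2 where tW: "tri UB D W (g \<cdot> b1) w1 w2" using obtains_cone[OF gb] .
  obtain K k1 k2 where tK: "tri UB UD K k k1 k2" using obtains_cone[OF k(1)] .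
  obtain x1 x2 x3 where tx: "tri VB W (S A) x1 x2 x3"
    using TR4[OF tB tW rotate[OF t]] by blast
  obtain y1 y2 y3 where ty: "tri K W VD y1 y2 y3"
    using TR4[OF tK tW[unfolded k(2)] tD] by blast
  \<comment> \<open>The cone \<open>Q\<close> of \<open>K -> W -> S A\<close> is an extension of
    \<open>S VB\<close> by \<open>VD\<close>.\<close>
  obtain Q q1 q2 where tQ: "tri K (S A) Q (x2 \<cdot> y1) q1 q2"
    using obtains_cone[OF Comp_Hom[OF tri_Hom(1)[OF ty] tri_Hom(2)[OF tx]]] .
  obtain z1 z2 z3 where tz: "tri VD Q (S VB) z1 z2 z3"
    using TR4[OF ty tQ rotate[OF tx]] by blast
  have "VD \<in> below (\<theta> + 1)" using below_mono UVD by simp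
  moreover have "S VB \<in> below (\<theta> + 1)" using below_S_iff below_Obj UVB by blast
  ultimately have Q: "Q \<in> below (\<theta> + 1)" using below_ext[OF tz] by blast
  have K: "K \<in> above \<theta>" using above_cone[OF tK] UVB UVD by blast
  obtain U V where U: "trunc (\<theta> + 1) K U V" using trunc_exists above_Obj K by blast
  then obtain R where "trunc (\<theta> + 1) (S A) U R" using trunc_extend[OF _ tQ Q] by blast
  hence "zeta U = zeta (S UA)" using trunc_unique trunc_S[OF A] by blast
  moreover have "UA \<in> Obj C" using A above_Obj unfolding trunc_def by blast
  ultimately have "zeta U = - zeta UA" using zeta_S by simp
  hence "- height \<theta> (zeta UA) \<le> height \<theta> (zeta K)" using height_above[OF K U] height_minus by simp
  moreover have "height \<theta> (zeta UD) = height \<theta> (zeta UB) + height \<theta> (zeta K)"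
    using zeta_tri[OF tK] height_add by simp
  ultimately show ?thesis
    using upper_eq[OF A] upper_eq[OF B] upper_eq[OF D] by simp
qed

lemma mass_triangle:
  assumes "tri X Y W f g h"
  shows "m Y \<le> m X + m W"
proof -
  obtain c where c:
    "((\<lambda>\<theta>. upper \<theta> Y) has_integral (m Y - Re (zeta Y * cis (pi * c))) / pi) {- c..c}"
    "((\<lambda>\<theta>. upper \<theta> X + upper \<theta> W) has_integral (m X + m W - Re (zeta Y * cis (pi * c))) / pi) {- c..c}"
    using mass_integrals[OF tri_Obj[OF assms] zeta_tri[OF assms]] .
  from has_integral_le[OF this] upper_subadditive[OF assms] show ?thesis
    by (simp add: divide_le_cancel)
qed

text \<open>The axioms provide cones rather than fibres, so the part of \<open>E\<close> above \<open>\<theta>\<close> is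
  constructed as an object \<open>Q\<close> that truncates the double shift of \<open>E\<close> at \<open>\<theta> + 2\<close>.\<close>

lemma trunc_split:
  assumes t: "tri X E Y i p (Zero C Y (S X))"
    and X: "trunc \<theta> X UX VX" and Y: "trunc \<theta> Y UY VY" and E: "trunc \<theta> E UE VE"
  shows "zeta UE = zeta UX + zeta UY"
proof -
  note O = tri_Obj[OF t]
  obtain y1 y2 y3 where tY: "tri UY Y VY y1 y2 y3" and UVY: "UY \<in> above \<theta>" "VY \<in> below \<theta>"
    using Y unfolding trunc_def by blast
  note OY = tri_Obj[OF tY] and HY = tri_Hom[OF tY]
  have UX: "UX \<in> Obj C" using X above_Obj unfolding trunc_def by blast
  \<comment> \<open>\<open>W\<close> is a shifted fibre of \<open>E -> VY\<close>; the octahedron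
    makes it an extension of \<open>S UY\<close> by \<open>S X\<close> with zero connecting
    map.\<close>
  obtain W w1 w2 where tW: "tri E VY W (y2 \<cdot> p) w1 w2"
    using obtains_cone[OF Comp_Hom[OF tri_Hom(2)[OF t] HY(2)]] .
  obtain a b where ab: "tri (S X) W (S UY) a b (Sh (Zero C Y (S X)) \<cdot> neg (Sh y1))"
    using TR4[OF rotate[OF t] tW rotate[OF tY]] by blast
  have zero: "Sh (Zero C Y (S X)) \<cdot> neg (Sh y1) = Zero C (S UY) (S (S X))"
    using Sh_Zero O S_Obj Zero_Comp[OF neg_Hom[OF Sh_Hom[OF HY(1)]]] by simp
  have SUY: "S UY \<in> Obj C" using S_Obj OY by blast
  have "(Sh (Zero C Y (S X)) \<cdot> neg (Sh y1)) \<cdot> Id C (S UY) = Zero C (S UY) (S (S X))"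
    unfolding zero by (rule Comp_Id[OF Zero_Hom]) (use SUY S_Obj O in blast)+
  \<comment> \<open>Because the connecting map vanishes, the identity lifts along \<open>b\<close>:
    \<open>s\<close> is a section.\<close>
  then obtain s where s: "s \<in> Hom C (S UY) W" "Id C (S UY) = b \<cdot> s"
    using tri_factor_left[OF rotate[OF ab] Id_Hom[OF SUY]] by blast
  obtain M mm1 mm2 where tM: "tri (S UY) W M s mm1 mm2" using obtains_cone[OF s(1)] .
  obtain N where N: "is_zero_object C N" using obtains_zero_object .
  have "tri (S UY) (S UY) N (b \<cdot> s) (Zero C (S UY) N) (Zero C N (S (S UY)))"
    using tri_Id[OF SUY N] s(2) by simp
  \<comment> \<open>As \<open>b \<cdot> s\<close> is the identity, its cone \<open>N\<close> is
    zero, and the octahedron makes the cone \<open>M\<close> of \<open>s\<close> a copy of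
    \<open>S X\<close>.\<close>
  then obtain c1 c2 c3 where tN: "tri M N (S (S X)) c1 c2 c3"
    using TR4[OF tM _ rotate[OF ab]] by blast
  obtain UM VM where M: "trunc (\<theta> + 1) M UM VM" using trunc_exists tri_Obj[OF tM] by blast
  obtain v1 v2 v3 where tv: "tri UM M VM v1 v2 v3" and UVM: "UM \<in> above (\<theta> + 1)" "VM \<in> below (\<theta> + 1)"
    using M unfolding trunc_def by blast
  have SSX: "trunc (\<theta> + 1 + 1) (S (S X)) (S (S UX)) (S (S VX))" using trunc_S X by blast
  have "S N \<in> below (\<theta> + 1 + 1)" using zero_below S_zero_iff N zero_object_Obj by blast
  then obtain R where "trunc (\<theta> + 1 + 1) (S M) (S (S UX)) R"
    using trunc_extend[OF SSX rotate[OF rotate[OF tN]]] by blast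
  hence "zeta (S (S UX)) = zeta (S UM)" using trunc_unique trunc_S[OF M] by blast
  hence UM: "zeta (S UM) = zeta UX" using zeta_S S_Obj UX by simp
  \<comment> \<open>\<open>Q\<close> is an extension of \<open>S UM\<close>, which has the central
    charge of \<open>UX\<close>, by \<open>S (S UY)\<close>.\<close>
  obtain Q q1 q2 where tQ: "tri W VM Q (v2 \<cdot> mm1) q1 q2"
    using obtains_cone[OF Comp_Hom[OF tri_Hom(2)[OF tM] tri_Hom(2)[OF tv]]] .
  obtain e1 e2 e3 where te: "tri (S (S UY)) Q (S UM) e1 e2 e3"
    using TR4[OF rotate[OF tM] tQ rotate[OF tv]] by blast
  have "S (S UY) \<in> above (\<theta> + 1 + 1)" "S UM \<in> above (\<theta> + 1 + 1)"
    using above_S UVY UVM by blast+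
  hence "Q \<in> above (\<theta> + 1 + 1)" using above_ext[OF te] by blast
  moreover have "S VM \<in> below (\<theta> + 1 + 1)" using below_S_iff below_Obj UVM by blast
  ultimately have SW: "trunc (\<theta> + 1 + 1) (S W) Q (S VM)"
    using rotate[OF rotate[OF tQ]] unfolding trunc_def by blast
  \<comment> \<open>\<open>S (S E)\<close> is an extension of \<open>S (S VY)\<close> by
    \<open>S W\<close>, so \<open>Q\<close> truncates it as well.\<close>
  have "S (S VY) \<in> below (\<theta> + 1 + 1)" using below_S_iff below_Obj UVY S_Obj by blast
  then obtain R' where "trunc (\<theta> + 1 + 1) (S (S E)) Q R'"
    using trunc_extend[OF SW rotate[OF rotate[OF rotate[OF rotate[OF rotate[OF tW]]]]]] by blast
  hence "zeta Q = zeta (S (S UE))" using trunc_unique trunc_S[OF trunc_S[OF E]] by blast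
  moreover have "UE \<in> Obj C" using E above_Obj unfolding trunc_def by blast
  ultimately have "zeta UE = zeta Q" using zeta_S S_Obj by simp
  thus ?thesis using zeta_tri[OF te] UM zeta_S S_Obj OY by simp
qed

lemma mass_split:
  assumes t: "tri X E Y i p (Zero C Y (S X))"
  shows "m E = m X + m Y"
proof -
  note O = tri_Obj[OF t]
  have "upper \<theta> E = upper \<theta> X + upper \<theta> Y" for \<theta>
  proof -
    obtain UX VX where X: "trunc \<theta> X UX VX" using trunc_exists[OF O(1)] .
    obtain UY VY where Y: "trunc \<theta> Y UY VY" using trunc_exists[OF O(3)] .
    obtain UE VE where E: "trunc \<theta> E UE VE" using trunc_exists[OF O(2)] .
    show ?thesis
      using trunc_split[OF t X Y E] upper_eq[OF X] upper_eq[OF Y] upper_eq[OF E] height_add by simp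
  qed
  moreover obtain c where c:
    "((\<lambda>\<theta>. upper \<theta> E) has_integral (m E - Re (zeta E * cis (pi * c))) / pi) {- c..c}"
    "((\<lambda>\<theta>. upper \<theta> X + upper \<theta> Y) has_integral (m X + m Y - Re (zeta E * cis (pi * c))) / pi) {- c..c}"
    using mass_integrals[OF O zeta_tri[OF t]] .
  ultimately have "(m E - Re (zeta E * cis (pi * c))) / pi
      = (m X + m Y - Re (zeta E * cis (pi * c))) / pi"
    using has_integral_unique[OF c(1)] c(2) by simp
  thus ?thesis by simp
qed

text \<open>Shifting a filtration raises all phases by one and negates the central charges, whose
  moduli stay the same.\<close>

lemma mass_S:
  assumes "X \<in> Obj C"
  shows "m (S X) = m X"
proof -
  obtain n Y \<phi> where HN: "HN_filtration C P X n Y \<phi>" using HN_exists[OF assms] .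
  then obtain F where F: "is_zero_object C (F 0)" "F n = X"
    and T: "\<And>i. i < n \<Longrightarrow> \<exists>T. is_exact_triangle C (F i) (F (Suc i)) (Y i) T"
    and Y: "\<And>i. i < n \<Longrightarrow> Y i \<in> P (\<phi> i) \<and> \<not> is_zero_object C (Y i)"
    and dec: "\<And>i j. i < j \<Longrightarrow> j < n \<Longrightarrow> \<phi> j < \<phi> i"
    unfolding HN_filtration_def by blast
  have "\<exists>T. is_exact_triangle C (S (F i)) (S (F (Suc i))) (S (Y i)) T" if "i < n" for i
  proof -
    obtain f g h where "tri (F i) (F (Suc i)) (Y i) f g h" using T[OF \<open>i < n\<close>] by auto
    thus ?thesis using rotate[OF rotate[OF rotate]] by blast
  qed
  moreover have "S (Y i) \<in> P (\<phi> i + 1) \<and> \<not> is_zero_object C (S (Y i))" if "i < n" for i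
    using Y[OF that] P_Shift S_zero_iff P_Obj by blast
  moreover have "is_zero_object C (S (F 0))" using F(1) S_zero_iff zero_object_Obj by blast
  ultimately have "HN_filtration C P (S X) n (\<lambda>i. S (Y i)) (\<lambda>i. \<phi> i + 1)"
    unfolding HN_filtration_def using F(2) dec
    by (intro conjI exI[of _ "\<lambda>i. S (F i)"] allI impI) simp_all
  moreover have "zeta (S (Y i)) = - zeta (Y i)" if "i < n" for i
    using zeta_S P_Obj Y[OF that] by blast
  ultimately show ?thesis using HN_mass[OF HN] HN_mass[of "S X"] by simp
qed

end

section \<open>Thin triangles\<close>

context triangulated_stability
begin

text \<open>Arrows determine their endpoints, so the objects bound in \<open>thin_triangles\<close>
  must be \<open>X\<close>, \<open>Y\<close> and \<open>W\<close>.\<close>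

lemma thin_iff:
  assumes "is_triangle C X Y W (f, g, h)"
  shows "(f, g, h) \<in> thin_triangles C P Z \<longleftrightarrow> tri X Y W f g h \<and> m Y = m X + m W"
  using assms
  by (auto simp: thin_triangles_def is_exact_triangle_def is_triangle_def Hom_def)

lemma conflation_iff:
  "is_conflation C (thin_triangles C P Z) X f Y g W \<longleftrightarrow> (\<exists>h. tri X Y W f g h) \<and> m Y = m X + m W"
  unfolding is_conflation_def using thin_iff by (auto simp: is_exact_triangle_def)

text \<open>The cone \<open>R\<close> of \<open>E \<rightarrow> W \<rightarrow> X[1]\<close> is \<open>(Y \<oplus> X')[1]\<close>.\<close>

lemma mass_pushout:
  assumes t: "tri X Y W x y d" and f: "f \<in> Hom C X X'" and t': "tri X' E W x' y' (Sh f \<cdot> d)"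
  shows "m X' + m Y \<le> m X + m E"
proof -
  note H = tri_Hom[OF t] and H' = tri_Hom[OF t'] and O = tri_Obj[OF t] and O' = tri_Obj[OF t']
  obtain R p q where tR: "tri E (S X) R (d \<cdot> y') p q"
    using obtains_cone[OF Comp_Hom[OF H'(2) H(3)]] .
  obtain a b where "tri (S X') R (S Y) a b (Sh (Sh f \<cdot> d) \<cdot> neg (Sh y))"
    using TR4[OF rotate[OF t'] tR rotate[OF rotate[OF t]]] by blast
  \<comment> \<open>The consecutive arrows \<open>y\<close> and \<open>d\<close> compose to zero, so
    the triangle \<open>S X' -> R -> S Y\<close> splits.\<close>
  moreover have "Sh (Sh f \<cdot> d) \<cdot> neg (Sh y) = Zero C (S Y) (S (S X'))"
  proof -
    have "Sh (Sh f \<cdot> d) \<cdot> neg (Sh y) = neg (Sh (Sh f \<cdot> d) \<cdot> Sh y)"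
      using Comp_neg Sh_Hom H(2) H'(3) by blast
    also have "Sh (Sh f \<cdot> d) \<cdot> Sh y = Sh (Sh f \<cdot> (d \<cdot> y))"
      using Shift_Comp[OF H(2) H'(3)] Comp_assoc[OF H(2,3) Sh_Hom[OF f]] by simp
    also have "d \<cdot> y = Zero C Y (S X)" using tri_comp_zero[OF rotate[OF t]] .
    also have "Sh (Sh f \<cdot> Zero C Y (S X)) = Zero C (S Y) (S (S X'))"
      using Comp_Zero[OF Sh_Hom[OF f] O(2)] Sh_Zero O O' S_Obj by simp
    finally show ?thesis using neg_Zero S_Obj O O' by simp
  qed
  ultimately have "m R = m (S X') + m (S Y)" using mass_split by simp
  moreover have "m R \<le> m (S X) + m (S E)" using mass_triangle[OF rotate[OF tR]] .
  ultimately show ?thesis using mass_S O O' by simp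
qed

text \<open>The cone \<open>R\<close> of \<open>W \<rightarrow> X[1] \<rightarrow> E[1]\<close> is \<open>(Y \<oplus> W')[1]\<close>.\<close>

lemma mass_pullback:
  assumes t: "tri X Y W x y d" and g: "g \<in> Hom C W' W" and t': "tri X E W' x' y' (d \<cdot> g)"
  shows "m Y + m W' \<le> m E + m W"
proof -
  note H = tri_Hom[OF t] and H' = tri_Hom[OF t'] and O = tri_Obj[OF t] and O' = tri_Obj[OF t']
  have nx': "neg (Sh x') \<in> Hom C (S X) (S E)" using neg_Hom Sh_Hom H'(1) by blast
  obtain R p q where tR: "tri W (S E) R (neg (Sh x') \<cdot> d) p q"
    using obtains_cone[OF Comp_Hom[OF H(3) nx']] .
  obtain a b where "tri (S Y) R (S W') a b (Sh (neg (Sh x)) \<cdot> neg (Sh (d \<cdot> g)))"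
    using TR4[OF rotate[OF rotate[OF t]] tR rotate[OF rotate[OF rotate[OF t']]]] by blast
  \<comment> \<open>Here \<open>neg (Sh x)\<close> follows \<open>d\<close> in a rotation of the
    first triangle, so \<open>S Y -> R -> S W'\<close> splits.\<close>
  moreover have "Sh (neg (Sh x)) \<cdot> neg (Sh (d \<cdot> g)) = Zero C (S W') (S (S Y))"
  proof -
    have nx: "neg (Sh x) \<in> Hom C (S X) (S Y)" using neg_Hom Sh_Hom H(1) by blast
    have "Sh (neg (Sh x)) \<cdot> neg (Sh (d \<cdot> g)) = neg (Sh (neg (Sh x)) \<cdot> Sh (d \<cdot> g))"
      using Comp_neg Sh_Hom nx H'(3) by blast
    also have "Sh (neg (Sh x)) \<cdot> Sh (d \<cdot> g) = Sh ((neg (Sh x) \<cdot> d) \<cdot> g)"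
      using Shift_Comp[OF H'(3) nx] Comp_assoc[OF g H(3) nx] by simp
    also have "neg (Sh x) \<cdot> d = Zero C W (S Y)"
      using tri_comp_zero[OF rotate[OF rotate[OF t]]] .
    also have "Sh (Zero C W (S Y) \<cdot> g) = Zero C (S W') (S (S Y))"
      using Zero_Comp[OF g] Sh_Zero O O' S_Obj by simp
    finally show ?thesis using neg_Zero S_Obj O O' by simp
  qed
  ultimately have "m R = m (S Y) + m (S W')" using mass_split by simp
  moreover have "m R \<le> m (S E) + m (S W)" using mass_triangle[OF rotate[OF tR]] .
  ultimately show ?thesis using mass_S O O' by simp
qed

text \<open>\<open>TR4\<close> speaks of cones, so it is applied to \<open>W -> Y -> W'\<close>;
  bijectivity of the shift on objects and morphisms then unshifts the result.\<close>

lemma octahedron_op: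
  assumes t: "tri X Y W' f f' l" and t': "tri X' W Y g g' k"
  obtains Y' h p d e where "tri Y' W W' h (f' \<cdot> g') p" "tri X' Y' X d e (k \<cdot> f)"
    "h \<cdot> d = g" "f \<cdot> e = g' \<cdot> h"
proof -
  note H = tri_Hom[OF t] and H' = tri_Hom[OF t'] and O = tri_Obj[OF t] and O' = tri_Obj[OF t']
  obtain Q p q where tQ: "tri W W' Q (f' \<cdot> g') p q"
    using obtains_cone[OF Comp_Hom[OF H'(2) H(2)]] .
  obtain a b where ab: "tri (S X') Q (S X) a b (Sh k \<cdot> neg (Sh f))"
    and qa: "q \<cdot> a = neg (Sh g)" and bq: "neg (Sh f) \<cdot> b = Sh g' \<cdot> q"
    using TR4[OF rotate[OF t'] tQ rotate[OF t]] by blast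
  obtain Y' where Y': "Y' \<in> Obj C" "Q = S Y'" using S_surj tri_Obj[OF tQ] by blast
  obtain h0 where h0: "h0 \<in> Hom C Y' W" "q = Sh h0"
    using Sh_surj Y' tri_Hom(3)[OF tQ] O' by blast
  obtain d where d: "d \<in> Hom C X' Y'" "a = Sh d"
    using Sh_surj Y' tri_Hom(1)[OF ab] O' by blast
  obtain e where e: "e \<in> Hom C Y' X" "b = Sh e"
    using Sh_surj Y' tri_Hom(2)[OF ab] O by blast
  \<comment> \<open>The third arrow of a rotated triangle carries a minus sign, which
    \<open>h\<close> absorbs.\<close>
  define h where "h = neg h0"
  have h: "h \<in> Hom C Y' W" and q: "q = neg (Sh h)"
    using h0 neg_Hom Sh_neg neg_neg neg_neg[OF Sh_Hom] by (simp_all add: h_def)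
  have kf: "k \<cdot> f \<in> Hom C X (S X')" using Comp_Hom H H' by blast
  have "Sh k \<cdot> neg (Sh f) = neg (Sh (k \<cdot> f))"
    using Comp_neg[OF Sh_Hom[OF H(1)] Sh_Hom[OF H'(3)]] Shift_Comp[OF H(1) H'(3)] by simp
  hence "tri X' Y' X d e (k \<cdot> f)"
    using ab shift_neg_iff[OF d(1) e(1) kf] d(2) e(2) Y'(2) by simp
  moreover have "tri Y' W W' h (f' \<cdot> g') p"
    using tQ rotate_iff[OF h] q Y'(2) by simp
  moreover have "h \<cdot> d = g"
  proof (rule Sh_inject[OF Comp_Hom[OF d(1) h] H'(1)], rule neg_inject)
    show "neg (Sh (h \<cdot> d)) = neg (Sh g)"
      using qa q d(2) neg_Comp[OF Sh_Hom[OF d(1)] Sh_Hom[OF h]] Shift_Comp[OF d(1) h] by simp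
  qed (rule Sh_Hom, use Comp_Hom d h H' in blast)+
  moreover have "f \<cdot> e = g' \<cdot> h"
  proof (rule Sh_inject[OF Comp_Hom[OF e(1) H(1)] Comp_Hom[OF h H'(2)]], rule neg_inject)
    show "neg (Sh (f \<cdot> e)) = neg (Sh (g' \<cdot> h))"
      using bq q e(2) neg_Comp[OF Sh_Hom[OF e(1)] Sh_Hom[OF H(1)]] Shift_Comp[OF e(1) H(1)]
        Comp_neg[OF Sh_Hom[OF h] Sh_Hom[OF H'(2)]] Shift_Comp[OF h H'(2)] by simp
  qed (rule Sh_Hom, use Comp_Hom e h H H' in blast)+
  ultimately show ?thesis using that by blast
qed

section \<open>The axioms of an extriangulated structure\<close>

lemma extriangulated_thin: "extriangulated_structure C (thin_triangles C P Z)"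
proof
  show "thin_triangles C P Z \<subseteq> Exact C"
    by (auto simp: thin_triangles_def is_exact_triangle_def)
next
  fix X Y W x y \<delta> f X' E x' y'
  assume "is_triangle C X Y W (x, y, \<delta>)" "(x, y, \<delta>) \<in> thin_triangles C P Z"
  hence t: "tri X Y W x y \<delta>" "m Y = m X + m W" using thin_iff by blast+
  assume f: "f \<in> Hom C X X'" and t': "tri X' E W x' y' (Sh f \<cdot> \<delta>)"
  have "m E = m X' + m W"
    using mass_pushout[OF t(1) f t'] mass_triangle[OF t'] t(2) by simp
  thus "(x', y', Sh f \<cdot> \<delta>) \<in> thin_triangles C P Z"
    using t' by (auto simp: thin_triangles_def)
next
  fix X Y W x y \<delta> g W' E x' y'
  assume "is_triangle C X Y W (x, y, \<delta>)" "(x, y, \<delta>) \<in> thin_triangles C P Z"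
  hence t: "tri X Y W x y \<delta>" "m Y = m X + m W" using thin_iff by blast+
  assume g: "g \<in> Hom C W' W" and t': "tri X E W' x' y' (\<delta> \<cdot> g)"
  have "m E = m X + m W'"
    using mass_pullback[OF t(1) g t'] mass_triangle[OF t'] t(2) by simp
  thus "(x', y', \<delta> \<cdot> g) \<in> thin_triangles C P Z"
    using t' by (auto simp: thin_triangles_def)
next
  fix X f Y f' W' g W g' X'
  assume "is_conflation C (thin_triangles C P Z) X f Y f' W'"
    and "is_conflation C (thin_triangles C P Z) Y g W g' X'"
  then obtain h k where t: "tri X Y W' f f' h" "m Y = m X + m W'"
    and t': "tri Y W X' g g' k" "m W = m Y + m X'"
    unfolding conflation_iff by blast
  obtain Y' h' q where tQ: "tri X W Y' (g \<cdot> f) h' q"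
    using obtains_cone[OF Comp_Hom[OF tri_Hom(1)[OF t(1)] tri_Hom(1)[OF t'(1)]]] .
  obtain d e where de: "tri W' Y' X' d e (Sh f' \<cdot> k)" "d \<cdot> f' = h' \<cdot> g" "e \<cdot> h' = g'"
    using TR4[OF t(1) tQ t'(1)] by blast
  \<comment> \<open>Squeeze: \<open>m W \<le> m X + m Y' \<le> m X + m W' + m X'\<close>, and the
    last sum is \<open>m W\<close> by thinness of the given triangles.\<close>
  have "m W = m X + m Y'" "m Y' = m W' + m X'"
    using mass_triangle[OF tQ] mass_triangle[OF de(1)] t(2) t'(2) by simp_all
  thus "\<exists>Y' h' d e. is_conflation C (thin_triangles C P Z) X (g \<cdot> f) W h' Y' \<and>
      is_conflation C (thin_triangles C P Z) W' d Y' e X' \<and> h' \<cdot> g = d \<cdot> f' \<and> e \<cdot> h' = g'"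
    unfolding conflation_iff using tQ de by metis
next
  fix X f Y f' W' X' g W g'
  assume "is_conflation C (thin_triangles C P Z) X f Y f' W'"
    and "is_conflation C (thin_triangles C P Z) X' g W g' Y"
  then obtain l k where t: "tri X Y W' f f' l" "m Y = m X + m W'"
    and t': "tri X' W Y g g' k" "m W = m X' + m Y"
    unfolding conflation_iff by blast
  obtain Y' h p d e where o: "tri Y' W W' h (f' \<cdot> g') p" "tri X' Y' X d e (k \<cdot> f)"
    "h \<cdot> d = g" "f \<cdot> e = g' \<cdot> h"
    using octahedron_op[OF t(1) t'(1)] .
  \<comment> \<open>The dual squeeze:
    \<open>m W \<le> m Y' + m W' \<le> m X' + m X + m W' = m W\<close>.\<close>
  have "m W = m Y' + m W'" "m Y' = m X' + m X"
    using mass_triangle[OF o(1)] mass_triangle[OF o(2)] t(2) t'(2) by simp_all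
  thus "\<exists>Y' h d e. is_conflation C (thin_triangles C P Z) Y' h W (f' \<cdot> g') W' \<and>
      is_conflation C (thin_triangles C P Z) X' d Y' e X \<and> h \<cdot> d = g \<and> f \<cdot> e = g' \<cdot> h"
    unfolding conflation_iff using o by metis
qed

end

theorem theorem2p4:
  fixes C :: "('o, 'm) triangulated_data"
    and P :: "real \<Rightarrow> 'o set"
    and Z :: "('o \<Rightarrow>\<^sub>0 int) set \<Rightarrow> complex"
  assumes "triangulated_category C"
    and "stability_condition C P Z"
  shows "extriangulated_structure C (thin_triangles C P Z)"
  by (rule triangulated_stability.extriangulated_thin[OF triangulated_stability.intro[OF assms]])

end
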